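(* There exists a constant $C_{W_2}>0$ (independent of $\lambda$, $n$ and $\mu$) such that for all integers $n\ge 1$ and all real $\lambda>0$, $\mu>0$ satisfying $1\le R<n$, where $R=\lambda/\mu$, $$d_{W_2}(\tilde X(\infty),Y(\infty)) \equiv \sup_{h\in W_2}\big|\mathbb{E}h(\tilde X(\infty))-\mathbb{E}h(Y(\infty))\big|\le \frac{C_{W_2}}{R}.$$
   Context: Erlang-C ($M/M/n$) system: $n$ homogeneous servers, Poisson arrivals with rate $\lambda$, i.i.d. exponential service times with mean $1/\mu$, first-come-first-served, infinite waiting room. The number of customers $X=\{X(t),t\ge0\}$ is a continuous time Markov chain on $\mathbb{Z}_+=\{0,1,2,\dots\}$ with transition rate $\lambda$ from $k$ to $k+1$ and rate $\mu\min(k,n)$ from $k$ to $k-1$. Offered load: $R=\lambda/\mu$. When $R<n$ the chain has a unique stationary distribution; $X(\infty)$ is a random variable with that distribution, and $\tilde X(\infty)=(X(\infty)-R)/\sqrt R$. Write $x^-=\max(-x,0)$, and $1(\cdot)$ for the indicator. Set $\zeta=(R-n)/\sqrt R<0$ and, for $x\in\mathbb{R}$, $$b(x)=\mu\big[(x+\zeta)^-+\zeta\big],\qquad a(x)=\mu\Big[1+1(x>-\sqrt R)\Big(1-\frac{(x+\zeta)^-+\zeta}{\sqrt R}\Big)\Big].$$ $Y(\infty)$ is a real-valued random variable with density $$\nu(x)=\frac{\kappa}{a(x)}\exp\Big(\int_0^x\frac{2b(y)}{a(y)}\,dy\Big),\quad x\in\mathbb{R},$$ where $\kappa>0$ is the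 normalizing constant. $\mathrm{Lip}(1)=\{h:\mathbb{R}\to\mathbb{R} : |h(x)-h(y)|\le|x-y| \text{ for all }x,y\in\mathbb{R}\}$, and $W_2$ is the set of differentiable $h:\mathbb{R}\to\mathbb{R}$ such that both $h$ and $h'$ belong to $\mathrm{Lip}(1)$. *)

theory Defs
  imports "HOL-Probability.Probability"
begin

text \<open>
  A time-homogeneous continuous time Markov chain on the natural numbers is given by its
  transition function: \<open>P t i\<close> is the law of the state at time \<open>t\<close> when the chain starts in \<open>i\<close>.
  The entry \<open>q i j\<close> of the rate matrix is the right derivative of \<open>t \<mapsto> P t i j\<close> at \<open>0\<close>, so the
  diagonal carries minus the total rate out of a state.
\<close>

definition ctmc_with_rates :: "(nat \<Rightarrow> nat \<Rightarrow> real) \<Rightarrow> (real \<Rightarrow> nat \<Rightarrow> nat pmf) \<Rightarrow> bool" where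
  "ctmc_with_rates q P \<longleftrightarrow>
     (\<forall>i. P 0 i = return_pmf i) \<and>
     (\<forall>s\<ge>0. \<forall>t\<ge>0. \<forall>i. P (s + t) i = bind_pmf (P s i) (P t)) \<and>
     (\<forall>i j. ((\<lambda>t. pmf (P t i) j) has_real_derivative q i j) (at 0 within {0..}))"

definition stationary_distribution :: "(real \<Rightarrow> nat \<Rightarrow> nat pmf) \<Rightarrow> nat pmf \<Rightarrow> bool" where
  "stationary_distribution P p \<longleftrightarrow> (\<forall>t\<ge>0. bind_pmf p (P t) = p)"

definition erlangC_rate :: "real \<Rightarrow> real \<Rightarrow> nat \<Rightarrow> nat \<Rightarrow> nat \<Rightarrow> real" where
  "erlangC_rate lam mu n i j =
     (if j = Suc i then lam
      else if i = Suc j then mu * real (min i n)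
      else if i = j then - (lam + mu * real (min i n))
      else 0)"

definition scaled_law :: "real \<Rightarrow> nat pmf \<Rightarrow> real measure" where
  "scaled_law R p = measure_pmf (map_pmf (\<lambda>k. (real k - R) / sqrt R) p)"

definition neg_part :: "real \<Rightarrow> real" where
  "neg_part x = max (- x) 0"

definition zeta :: "real \<Rightarrow> nat \<Rightarrow> real" where
  "zeta R n = (R - real n) / sqrt R"

definition drift :: "real \<Rightarrow> real \<Rightarrow> nat \<Rightarrow> real \<Rightarrow> real" where
  "drift R mu n x = mu * (neg_part (x + zeta R n) + zeta R n)"

definition diffusion :: "real \<Rightarrow> real \<Rightarrow> nat \<Rightarrow> real \<Rightarrow> real" where
  "diffusion R mu n x =
     mu * (1 + indicator {- sqrt R<..} x *
                 (1 - (neg_part (x + zeta R n) + zeta R n) / sqrt R))"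

text \<open>The interval integral is signed, as needed for negative \<open>x\<close>.\<close>

definition unnormalized_density :: "real \<Rightarrow> real \<Rightarrow> nat \<Rightarrow> real \<Rightarrow> real" where
  "unnormalized_density R mu n x =
     1 / diffusion R mu n x *
     exp (LBINT y=ereal 0..ereal x. 2 * drift R mu n y / diffusion R mu n y)"

definition kappa :: "real \<Rightarrow> real \<Rightarrow> nat \<Rightarrow> real" where
  "kappa R mu n = 1 / (LBINT x. unnormalized_density R mu n x)"

definition diffusion_density :: "real \<Rightarrow> real \<Rightarrow> nat \<Rightarrow> real \<Rightarrow> real" where
  "diffusion_density R mu n x = kappa R mu n * unnormalized_density R mu n x"

definition diffusion_law :: "real \<Rightarrow> real \<Rightarrow> nat \<Rightarrow> real measure" where
  "diffusion_law R mu n = density lborel (\<lambda>x. ennreal (diffusion_density R mu n x))"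

definition Lip1 :: "(real \<Rightarrow> real) set" where
  "Lip1 = {h. 1-lipschitz_on UNIV h}"

definition W2 :: "(real \<Rightarrow> real) set" where
  "W2 = {h. (\<forall>x. h differentiable at x) \<and> h \<in> Lip1 \<and> deriv h \<in> Lip1}"

text \<open>
  The supremum is taken in the extended reals: on \<open>real\<close> the supremum of an unbounded set
  would be an unspecified number.
\<close>

definition d_W2 :: "real measure \<Rightarrow> real measure \<Rightarrow> ereal" where
  "d_W2 M N = (SUP h\<in>W2. ereal \<bar>(\<integral>x. h x \<partial>M) - (\<integral>x. h x \<partial>N)\<bar>)"

end

theory Submission
  imports Defs
begin

text \<open>
  Stationarity yields detailed balance for the chain. With \<open>h - E h(Y)\<close> as right-hand side, the Stein
  equation \<open>a g' / 2 + b g = E h(Y) - h\<close> of the diffusion is of first order in \<open>g\<close> (the derivative of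
  the solution of the Poisson equation), and only \<open>g\<close> and \<open>g'\<close> have to be bounded. The law of the
  scaled chain is replaced by its convolution with the triangular kernel on one lattice cell, that is,
  by the piecewise linear interpolation \<open>\<rho>\<close> of the stationary weights; for \<open>h\<close> in \<open>W2\<close> this costs
  \<open>O(1/R)\<close>. Integrating \<open>\<rho> (a g' / 2 + b g)\<close> by parts on a cell leaves \<open>g\<close> times
  \<open>b \<rho> - (a \<rho> / 2)'\<close>, which detailed balance turns into a term of relative order \<open>1/R\<close> plus a term of
  order \<open>1 / sqrt R\<close> that is odd about the centre of the cell; the latter gains a factor \<open>1 / sqrt R\<close> from
  a second integration by parts. With \<open>s = -zeta\<close>, \<open>g\<close> is of size \<open>1 + 1/s\<close> to the left of \<open>s\<close>, where
  the chain spends a fraction of time of order \<open>min 1 s\<close>, so that all bounds are uniform in \<open>s\<close>.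
\<close>

section \<open>Detailed balance\<close>

text \<open>Comparing the two generators by Taylor expansion would involve \<open>g''\<close> and
  \<open>g'''\<close>, and the kinks of \<open>a\<close> and \<open>b\<close> spoil the regularity
  of \<open>g'\<close>. Smoothing the chain rather than expanding \<open>g\<close> avoids both. It
  leaves no error from the coefficients, because the kinks are lattice points:
  \<open>- sqrt R = grid 0\<close> and \<open>s = grid n\<close>. So \<open>a\<close> and
  \<open>b\<close> are affine on each cell and the defect of \<rho> is an explicit polynomial in the
  cell coordinate \<theta>. One more cell lies to the left of \<open>grid 0\<close>, because the
  kernel around state 0 reaches below it. To the right of \<open>s\<close> no bound on
  \<open>g\<close> is available that is uniform in \<open>x\<close>. There, however, the
  coefficients are constant and the defect is purely odd, so only \<open>g'\<close> enters: its
  bound \<open>1 / s\<close> meets the defect's factor \<open>s^2\<close>, and \<open>s\<close>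
  times the mass of that region is at most 1. The constant 30000 exceeds 36 * 400 * 2 + 3. Here 36
  is from the third moment, 400 from the Stein solution, 2 bounds
  \<open>(1 + 1 / s) * min 1 s\<close>, and 3 is 1 for the tail cells plus 2 for the
  smoothing.\<close>

lemma supermultiplicative_ge_tangent:
  fixes f :: "real \<Rightarrow> real"
  assumes nonneg: "\<And>t. t \<ge> 0 \<Longrightarrow> f t \<ge> 0" and f0: "f 0 = 1"
    and super: "\<And>s t. s \<ge> 0 \<Longrightarrow> t \<ge> 0 \<Longrightarrow> f s * f t \<le> f (s + t)"
    and deriv: "(f has_real_derivative q) (at 0 within {0..})"
    and t: "t > 0"
  shows "1 + q * t \<le> f t"
proof -
  \<comment> \<open>Splitting \<open>t\<close> into \<open>m\<close> equal steps gives
    \<open>f t \<ge> f (t / m) ^ m\<close>; Bernoulli's inequality then carries the slope at 0 over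
    to every \<open>t\<close>.\<close>
  have pow: "f x ^ m \<le> f (real m * x)" if "x \<ge> 0" for x m
  proof (induction m)
    case (Suc m)
    have "f x ^ Suc m \<le> f x * f (real m * x)"
      using Suc nonneg[OF that] by (simp add: mult_left_mono)
    also have "\<dots> \<le> f (x + real m * x)" using that by (intro super) auto
    finally show ?case by (simp add: algebra_simps)
  qed (simp add: f0)
  have step: "1 + (q - e) * t \<le> f t" if e: "e > 0" for e
  proof -
    have "((\<lambda>x. (f x - f 0) / (x - 0)) \<longlongrightarrow> q) (at 0 within {0..})"
      using deriv by (simp add: has_field_derivative_iff)
    then have "\<forall>\<^sub>F x in at 0 within {0..}. q - e < (f x - f 0) / (x - 0)"
      by (rule order_tendstoD) (use e in auto)
    then obtain d where d: "d > 0" "\<And>x. x \<in> {0..} \<Longrightarrow> x \<noteq> 0 \<Longrightarrow> dist x 0 < d \<Longrightarrow> q - e < (f x - 1) / x"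
      by (auto simp: eventually_at f0)
    \<comment> \<open>The first bound brings \<open>t / m\<close> within the range \<open>d\<close>
      of the difference quotient, the second ensures \<open>(q - e) * t / m \<ge> -1\<close> for
      Bernoulli.\<close>
    obtain m :: nat where m: "real m > max (t / d) (\<bar>q - e\<bar> * t)" using reals_Archimedean2 by blast
    have m0: "real m > 0" using m t d by (smt (verit, best) divide_pos_pos)
    define x where "x = t / real m"
    have x: "x > 0" "x < d" "real m * x = t" using m m0 t d
      by (auto simp: x_def divide_simps mult.commute)
    have "\<bar>q - e\<bar> * x < 1" using m m0 by (simp add: x_def divide_simps)
    then have xq: "-1 \<le> (q - e) * x" using x(1)
      by (smt (verit, ccfv_SIG) abs_mult abs_of_pos abs_ge_self abs_minus_cancel mult_minus_left)
    have "(q - e) * x \<le> f x - 1" using d(2)[of x] x by (simp add: dist_real_def divide_simps)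
    then have "1 + (q - e) * x \<le> f x" by simp
    have "1 + (q - e) * t = 1 + real m * ((q - e) * x)" using x by (simp add: algebra_simps flip: x(3))
    also have "\<dots> \<le> (1 + (q - e) * x) ^ m" by (rule Bernoulli_inequality[OF xq])
    also have "\<dots> \<le> f x ^ m" using xq \<open>1 + (q - e) * x \<le> f x\<close> by (intro power_mono) auto
    also have "\<dots> \<le> f t" using pow[of x m] x by simp
    finally show ?thesis .
  qed
  show ?thesis
  proof (rule field_le_epsilon)
    fix e :: real assume "e > 0"
    then have "1 + (q - e / t) * t \<le> f t" using t by (intro step) auto
    then show "1 + q * t \<le> f t + e" using t by (simp add: left_diff_distrib)
  qed
qed

text \<open>Keeping only the intermediate state \<open>i\<close> in the Chapman-Kolmogorov sum makes
  the return probability supermultiplicative. The resulting bound holds for every \<open>t\<close>,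
  whereas differentiability at 0 controls only small \<open>t\<close>, in a way that depends on
  \<open>i\<close>.\<close>

lemma ctmc_diagonal_ge:
  assumes P: "ctmc_with_rates q P" and t: "t > 0"
  shows "1 + q i i * t \<le> pmf (P t i) i"
proof (rule supermultiplicative_ge_tangent[where f = "\<lambda>t. pmf (P t i) i", OF _ _ _ _ t])
  fix s t :: real assume st: "s \<ge> 0" "t \<ge> 0"
  have "pmf (P s i) i * pmf (P t i) i = (\<integral>j. indicator {i} j * pmf (P t i) i \<partial>measure_pmf (P s i))"
    by (simp add: measure_pmf_single)
  also have "\<dots> \<le> (\<integral>j. pmf (P t j) i \<partial>measure_pmf (P s i))"
    by (intro integral_mono measure_pmf.integrable_const_bound[where B = 1])
       (auto simp: indicator_def pmf_le_1)
  also have "\<dots> = pmf (P (s + t) i) i"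
    using P st by (simp add: ctmc_with_rates_def pmf_bind)
  finally show "pmf (P s i) i * pmf (P t i) i \<le> pmf (P (s + t) i) i" .
qed (use P in \<open>auto simp: ctmc_with_rates_def\<close>)

text \<open>Mass found at \<open>j \<noteq> i\<close> has left \<open>i\<close>, so the off-diagonal
  entries are controlled by the diagonal one. The bound is uniform in \<open>j\<close>.\<close>

lemma ctmc_increment_bound:
  assumes P: "ctmc_with_rates q P" and t: "t > 0"
  shows "\<bar>pmf (P t i) j - pmf (P 0 i) j\<bar> \<le> - q i i * t"
proof (cases "i = j")
  case True
  then show ?thesis using ctmc_diagonal_ge[OF P t, of i] P pmf_le_1[of "P t i" i]
    by (simp add: ctmc_with_rates_def)
next
  case False
  have "pmf (P t i) i + pmf (P t i) j = measure (P t i) {i, j}"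
    using False by (simp add: measure_measure_pmf_finite)
  also have "\<dots> \<le> 1" by simp
  finally show ?thesis using ctmc_diagonal_ge[OF P t, of i] P False pmf_nonneg[of "P t i" j]
    by (simp add: ctmc_with_rates_def)
qed

text \<open>Under a stationary law the difference quotients of \<open>P\<close> average to zero, and
  by \<open>ctmc_increment_bound\<close> they are dominated by the constant \<open>c\<close>; so the
  limit at time 0 passes under the expectation.\<close>

lemma stationary_global_balance:
  assumes P: "ctmc_with_rates q P" and p: "stationary_distribution P p"
    and bound: "\<And>i. - q i i \<le> c"
  shows "(\<integral>i. q i j \<partial>measure_pmf p) = 0"
proof -
  define t where "t = (\<lambda>m. 1 / real (Suc m))"
  have t0: "t m > 0" for m by (simp add: t_def)
  define r where "r = (\<lambda>m i. (pmf (P (t m) i) j - pmf (P 0 i) j) / t m)"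
  have "(\<lambda>m. \<integral>i. r m i \<partial>measure_pmf p) \<longlonglongrightarrow> (\<integral>i. q i j \<partial>measure_pmf p)"
  proof (rule integral_dominated_convergence[where w = "\<lambda>_. c"])
    have "(\<lambda>m. r m i) \<longlonglongrightarrow> q i j" for i
    proof -
      have "((\<lambda>t. (pmf (P t i) j - pmf (P 0 i) j) / (t - 0)) \<longlongrightarrow> q i j) (at 0 within {0..})"
        using P unfolding ctmc_with_rates_def has_field_derivative_iff by blast
      moreover have "t \<longlonglongrightarrow> 0" unfolding t_def
        by (rule LIMSEQ_Suc[OF lim_1_over_n])
      then have "filterlim t (at 0 within {0..}) sequentially"
        using t0 by (auto simp: filterlim_at eventually_sequentially less_le)
      ultimately show ?thesis unfolding r_def by (auto dest: filterlim_compose)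
    qed
    then show "AE i in measure_pmf p. (\<lambda>m. r m i) \<longlonglongrightarrow> q i j" by simp
    have "norm (r m i) \<le> c" for m i
    proof -
      have "\<bar>pmf (P (t m) i) j - pmf (P 0 i) j\<bar> \<le> c * t m"
        using ctmc_increment_bound[OF P t0, of m i j] mult_right_mono[OF bound[of i], of "t m"] t0[of m]
        by linarith
      then show ?thesis using t0[of m] by (simp add: r_def divide_simps)
    qed
    then show "AE i in measure_pmf p. norm (r m i) \<le> c" for m by simp
  qed auto
  moreover have "(\<integral>i. r m i \<partial>measure_pmf p) = 0" for m
  proof -
    have "(\<integral>i. pmf (P x i) j \<partial>measure_pmf p) = pmf p j" if "x \<ge> 0" for x
      using p that by (simp add: stationary_distribution_def flip: pmf_bind)
    moreover have "integrable (measure_pmf p) (\<lambda>i. pmf (P x i) j)" for x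
      by (intro measure_pmf.integrable_const_bound[where B = 1]) (auto simp: pmf_le_1)
    ultimately show ?thesis using t0[of m] by (simp add: r_def less_imp_le)
  qed
  ultimately show ?thesis by (simp add: LIMSEQ_const_iff)
qed

text \<open>Global balance at 0 is the cut equation between 0 and 1, and each further balance
  equation passes the cut equation on to the next pair of states.\<close>

lemma erlangC_detailed_balance:
  assumes P: "ctmc_with_rates (erlangC_rate lam mu n) P" and p: "stationary_distribution P p"
    and pos: "lam > 0" "mu > 0"
  shows "lam * pmf p k = mu * real (min (Suc k) n) * pmf p (Suc k)"
proof -
  let ?q = "erlangC_rate lam mu n"
  \<comment> \<open>Column \<open>j\<close> of the rate matrix lives on \<open>j\<close> and its
    neighbours; truncated subtraction makes the range \<open>{0, 1}\<close> at
    \<open>j = 0\<close>.\<close>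
  have bal: "(\<Sum>i\<in>{j - 1..Suc j}. ?q i j * pmf p i) = 0" for j
  proof -
    have "(\<integral>i. ?q i j \<partial>measure_pmf p) = 0"
      by (rule stationary_global_balance[OF P p, of "lam + mu * real n"])
         (use pos in \<open>auto simp: erlangC_rate_def\<close>)
    moreover have "(\<integral>i. ?q i j \<partial>measure_pmf p) = (\<Sum>i\<in>{j - 1..Suc j}. ?q i j * pmf p i)"
      by (rule integral_measure_pmf_real) (auto simp: erlangC_rate_def split: if_splits)
    ultimately show ?thesis by simp
  qed
  show ?thesis
  proof (induction k)
    case 0
    have "{0..Suc 0} = {0, Suc 0}" by auto
    then show ?case using bal[of 0] by (simp add: erlangC_rate_def)
  next
    case (Suc k)
    have "{Suc k - 1..Suc (Suc k)} = {k, Suc k, Suc (Suc k)}" by auto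
    then have "lam * pmf p k - (lam + mu * real (min (Suc k) n)) * pmf p (Suc k)
        + mu * real (min (Suc (Suc k)) n) * pmf p (Suc (Suc k)) = 0"
      using bal[of "Suc k"] by (simp add: erlangC_rate_def algebra_simps)
    then show ?case using Suc by (simp add: algebra_simps)
  qed
qed

section \<open>Moments of the stationary law\<close>

lemma nat_pmf_expectation_sums:
  fixes f :: "nat \<Rightarrow> real"
  assumes "integrable (measure_pmf p) f"
  shows "(\<lambda>k. pmf p k * f k) sums (\<integral>k. f k \<partial>measure_pmf p)"
proof -
  have "integrable (count_space UNIV) (\<lambda>k. pmf p k * f k)"
    using assms by (subst (asm) measure_pmf_eq_density, subst (asm) integrable_density) auto
  then have "(\<lambda>k. pmf p k * f k) sums (\<integral>k. pmf p k * f k \<partial>count_space UNIV)"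
    by (rule sums_integral_count_space_nat)
  also have "(\<integral>k. pmf p k * f k \<partial>count_space UNIV) = (\<integral>k. f k \<partial>measure_pmf p)"
    unfolding measure_pmf_eq_density by (subst integral_density) auto
  finally show ?thesis .
qed

lemma nat_pmf_integrable:
  fixes f :: "nat \<Rightarrow> real"
  assumes "summable (\<lambda>k. pmf p k * \<bar>f k\<bar>)"
  shows "integrable (measure_pmf p) f"
proof -
  have "integrable (count_space UNIV) (\<lambda>k. pmf p k * f k)"
    using assms by (subst integrable_count_space_nat_iff) (simp add: abs_mult)
  then show ?thesis
    by (subst measure_pmf_eq_density, subst integrable_density) auto
qed

text \<open>Detailed balance divided by \<open>mu\<close> is all that is kept of the chain, so
  \<open>mu\<close> drops out of the estimates.\<close>

locale erlangC_law =
  fixes n :: nat and R :: real and p :: "nat pmf"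
  assumes R1: "1 \<le> R" and Rn: "R < real n"
    and balance: "\<And>k. R * pmf p k = real (min (Suc k) n) * pmf p (Suc k)"
begin

text \<open>\<open>dl\<close> is the lattice spacing, \<open>s\<close> is \<open>-zeta\<close> and \<open>v\<close> is the scaled number of idle servers, so that
  the drift at \<open>grid k\<close> is \<open>v k - s\<close> (with \<open>mu = 1\<close>).\<close>

definition dl :: real where "dl = 1 / sqrt R"
definition s :: real where "s = (real n - R) * dl"
definition grid :: "nat \<Rightarrow> real" where "grid k = (real k - R) * dl"
definition v :: "nat \<Rightarrow> real" where "v k = dl * (real n - real (min k n))"

lemma dl_pos: "0 < dl" and dl_le_1: "dl \<le> 1" and dl_sqrt: "sqrt R * dl = 1"
  and dl2: "dl * dl * R = 1" and s_pos: "0 < s"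
proof -
  show "0 < dl" "dl \<le> 1" "sqrt R * dl = 1" using R1 by (auto simp: dl_def)
  show "dl * dl * R = 1" using R1 by (simp add: dl_def)
  show "0 < s" using R1 Rn by (simp add: s_def dl_def)
qed

lemma v_nonneg: "0 \<le> v k" and v_Suc: "v (Suc k) = max 0 (v k - dl)"
  and v_eq_0: "k \<ge> n \<Longrightarrow> v k = 0" and grid_v: "k \<le> n \<Longrightarrow> grid k = s - v k"
  and v_ge_dl: "k < n \<Longrightarrow> dl \<le> v k"
proof -
  show "0 \<le> v k" using dl_pos by (auto simp: v_def)
  show *: "dl \<le> v k" if "k < n"
    using mult_left_mono[of 1 "real n - real k" dl] that dl_pos by (simp add: v_def)
  show "v (Suc k) = max 0 (v k - dl)"
  proof (cases "k < n")
    case True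
    then have "v (Suc k) = v k - dl" by (simp add: v_def algebra_simps)
    with *[OF True] show ?thesis by simp
  qed (use dl_pos in \<open>auto simp: v_def\<close>)
  show "v k = 0" if "k \<ge> n" using that by (simp add: v_def)
  show "grid k = s - v k" if "k \<le> n" using that by (simp add: grid_def s_def v_def algebra_simps)
qed

text \<open>\<open>v\<close> has only the finitely many values \<open>dl * (n - j)\<close> with
  \<open>j \<le> n\<close>, so every function of it is bounded.\<close>

lemma integrable_v: "integrable (measure_pmf p) (\<lambda>k. \<phi> (v k) :: real)"
proof -
  let ?f = "\<lambda>j. \<phi> (dl * (real n - real j)) :: real"
  have "\<bar>\<phi> (v k)\<bar> \<le> (\<Sum>j\<le>n. \<bar>?f j\<bar>)" for k
    using member_le_sum[of "min k n" "{..n}" "\<lambda>j. \<bar>?f j\<bar>"] by (simp add: v_def)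
  then show ?thesis
    by (intro measure_pmf.integrable_const_bound[where B = "\<Sum>j\<le>n. \<bar>?f j\<bar>"]) auto
qed

abbreviation E :: "(nat \<Rightarrow> real) \<Rightarrow> real" where "E f \<equiv> \<integral>k. f k \<partial>measure_pmf p"

text \<open>Detailed balance summed against \<phi>, with the index shifted by one; the term lost in
  the shift is zero because \<open>min 0 n = 0\<close>. This discrete Stein identity, used with
  powers and truncations as \<phi>, is the source of the moment bounds below.\<close>

lemma stein: "E (\<lambda>k. (v k - s) * \<phi> (v k)) = E (\<lambda>k. sqrt R * (\<phi> (v k) - \<phi> (max 0 (v k - dl))))"
proof -
  have "(\<lambda>k. pmf p (Suc k) * (real (min (Suc k) n) * \<phi> (v (Suc k)))) sums
      (E (\<lambda>k. real (min k n) * \<phi> (v k)) - pmf p 0 * (real (min 0 n) * \<phi> (v 0)))"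
  proof -
    have min_v: "real (min k n) = real n - v k / dl" for k using dl_pos by (simp add: v_def)
    have "integrable (measure_pmf p) (\<lambda>k. real (min k n) * \<phi> (v k))"
      unfolding min_v by (rule integrable_v[of "\<lambda>x. (real n - x / dl) * \<phi> x"])
    from nat_pmf_expectation_sums[OF this] show ?thesis by (subst sums_Suc_iff) simp
  qed
  moreover have "(\<lambda>k. pmf p k * (R * \<phi> (v (Suc k)))) sums E (\<lambda>k. R * \<phi> (v (Suc k)))"
    unfolding v_Suc by (intro nat_pmf_expectation_sums integrable_v[of "\<lambda>x. R * \<phi> (max 0 (x - dl))"])
  moreover have "pmf p k * (R * \<phi> (v (Suc k))) = pmf p (Suc k) * (real (min (Suc k) n) * \<phi> (v (Suc k)))" for k
    using balance[of k] by (simp add: mult.assoc mult.commute mult.left_commute)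
  ultimately have *: "E (\<lambda>k. real (min k n) * \<phi> (v k)) = E (\<lambda>k. R * \<phi> (v (Suc k)))"
    using sums_unique2 by fastforce
  have int1: "integrable (measure_pmf p) (\<lambda>k. R * dl * \<phi> (v k))"
    by (rule integrable_v[of "\<lambda>x. R * dl * \<phi> x"])
  have int2: "integrable (measure_pmf p) (\<lambda>k. dl * (real (min k n) * \<phi> (v k)))"
  proof -
    have min_v: "real (min k n) = real n - v k / dl" for k using dl_pos by (simp add: v_def)
    show ?thesis unfolding min_v by (rule integrable_v[of "\<lambda>x. dl * ((real n - x / dl) * \<phi> x)"])
  qed
  have int3: "integrable (measure_pmf p) (\<lambda>k. dl * (R * \<phi> (v (Suc k))))"
    unfolding v_Suc by (rule integrable_v[of "\<lambda>x. dl * (R * \<phi> (max 0 (x - dl)))"])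
  have "E (\<lambda>k. (v k - s) * \<phi> (v k)) = E (\<lambda>k. R * dl * \<phi> (v k) - dl * (real (min k n) * \<phi> (v k)))"
    by (intro Bochner_Integration.integral_cong) (auto simp: v_def s_def algebra_simps)
  also have "\<dots> = E (\<lambda>k. R * dl * \<phi> (v k)) - E (\<lambda>k. dl * (R * \<phi> (v (Suc k))))"
    using * by (simp add: Bochner_Integration.integral_diff[OF int1 int2])
  also have "\<dots> = E (\<lambda>k. R * dl * \<phi> (v k) - dl * (R * \<phi> (v (Suc k))))"
    by (simp add: Bochner_Integration.integral_diff[OF int1 int3])
  also have "R * dl = sqrt R" using R1 by (simp add: dl_def real_div_sqrt)
  then have "(\<lambda>k. R * dl * \<phi> (v k) - dl * (R * \<phi> (v (Suc k)))) =
    (\<lambda>k. sqrt R * (\<phi> (v k) - \<phi> (max 0 (v k - dl))))"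
    by (auto simp: v_Suc right_diff_distrib mult.assoc[symmetric] mult.commute[of dl])
  finally show ?thesis .
qed

section \<open>Moments and occupation probabilities from the discrete Stein identity\<close>

lemma E_mono:
  assumes "\<And>x. x \<ge> 0 \<Longrightarrow> \<phi> x \<le> \<psi> x"
  shows "E (\<lambda>k. \<phi> (v k)) \<le> E (\<lambda>k. \<psi> (v k))"
  by (intro integral_mono integrable_v assms v_nonneg)

lemma E_mono_k:
  assumes "\<And>k. f k \<le> \<psi> (v k)" and "\<And>k. \<bar>f k\<bar> \<le> \<psi>' (v k)"
  shows "E f \<le> E (\<lambda>k. \<psi> (v k))"
proof (rule integral_mono[OF _ integrable_v[of \<psi>] assms(1)])
  have "\<bar>f k\<bar> \<le> \<bar>\<psi>' (v k)\<bar>" for k using assms(2)[of k] by linarith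
  then show "integrable (measure_pmf p) f"
    by (intro Bochner_Integration.integrable_bound[OF integrable_v[of \<psi>']]) auto
qed

lemma E_v: "E v = s"
proof -
  have "E (\<lambda>k. (v k - s) * 1) = E (\<lambda>k. sqrt R * (1 - 1))" by (rule stein)
  moreover have "E (\<lambda>k. v k - s) = E v - E (\<lambda>k. s)"
    by (intro Bochner_Integration.integral_diff integrable_v[of "\<lambda>x. x"] integrable_v[of "\<lambda>x. s"])
  ultimately show ?thesis by simp
qed

lemma E_v_linear: "E (\<lambda>k. \<phi> (v k) + c * \<psi> (v k)) = E (\<lambda>k. \<phi> (v k)) + c * E (\<lambda>k. \<psi> (v k))"
  by (subst Bochner_Integration.integral_add)
     (use integrable_v[of \<phi>] integrable_v[of "\<lambda>x. c * \<psi> x"] in auto)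

text \<open>With \<open>x - s\<close> as \<phi> the increment is at most \<open>dl\<close>, since
  truncation at 0 only shortens it, and \<open>sqrt R * dl = 1\<close>.\<close>

lemma E_v_centered_2: "E (\<lambda>k. (v k - s)^2) \<le> 1"
proof -
  have "E (\<lambda>k. (v k - s) * (v k - s)) = E (\<lambda>k. sqrt R * ((v k - s) - (max 0 (v k - dl) - s)))"
    by (rule stein)
  also have "\<dots> \<le> E (\<lambda>k. sqrt R * dl)"
    by (intro E_mono[of "\<lambda>x. sqrt R * ((x - s) - (max 0 (x - dl) - s))" "\<lambda>x. sqrt R * dl"] mult_left_mono)
       (use R1 in auto)
  finally show ?thesis using dl_sqrt by (simp add: power2_eq_square)
qed

text \<open>Here \<phi> is \<open>(x - s)^3\<close>. The mixed term of its increment is absorbed by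
  a square, which together with \<open>dl \<le> 1\<close> produces 9/2 and 5/2, and these add up to
  7 by \<open>E_v_centered_2\<close>.\<close>

lemma E_v_centered_4: "E (\<lambda>k. (v k - s)^4) \<le> 7"
proof -
  have "E (\<lambda>k. (v k - s)^4) = E (\<lambda>k. (v k - s) * (v k - s)^3)"
    by (simp add: power4_eq_xxxx power3_eq_cube mult.assoc)
  also have "\<dots> = E (\<lambda>k. sqrt R * ((v k - s)^3 - (max 0 (v k - dl) - s)^3))"
    by (rule stein)
  also have "\<dots> \<le> E (\<lambda>k. 5/2 + 9/2 * (v k - s)^2)"
  proof (rule E_mono[of "\<lambda>x. sqrt R * ((x - s)^3 - (max 0 (x - dl) - s)^3)" "\<lambda>x. 5/2 + 9/2 * (x - s)^2"])
    fix x :: real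
    define b where "b = x - s"
    have mono: "(b - dl)^3 \<le> (max 0 (x - dl) - s)^3"
      by (intro power_mono_odd) (auto simp: b_def)
    have "sqrt R * (b^3 - (b - dl)^3) = (sqrt R * dl) * (3 * b^2 - 3 * b * dl + dl^2)"
      by (simp add: algebra_simps power2_eq_square power3_eq_cube)
    also have "\<dots> = 3 * b^2 - 3 * b * dl + dl^2" using dl_sqrt by simp
    also have "\<dots> \<le> 5/2 + 9/2 * b^2"
    proof -
      have "0 \<le> 3/2 * (b + dl)^2" by simp
      then have "- 3 * b * dl \<le> 3/2 * b^2 + 3/2 * dl^2" by (simp add: power2_eq_square algebra_simps)
      moreover have "dl^2 \<le> 1" using dl_pos dl_le_1 by (simp add: power_le_one)
      ultimately show ?thesis by linarith
    qed
    finally have 1: "sqrt R * (b^3 - (b - dl)^3) \<le> 5/2 + 9/2 * b^2" .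
    have "sqrt R * (b^3 - (max 0 (x - dl) - s)^3) \<le> sqrt R * (b^3 - (b - dl)^3)"
      using mono R1 by (intro mult_left_mono) auto
    with 1 show "sqrt R * ((x - s)^3 - (max 0 (x - dl) - s)^3) \<le> 5/2 + 9/2 * (x - s)^2"
      by (simp add: b_def)
  qed
  also have "\<dots> = 5/2 + 9/2 * E (\<lambda>k. (v k - s)^2)"
    using E_v_linear[of "\<lambda>x. 5/2" "9/2" "\<lambda>x. (x - s)^2"] by simp
  also have "\<dots> \<le> 7" using E_v_centered_2 by simp
  finally show ?thesis .
qed

lemma E_v_square: "E (\<lambda>k. (v k)^2) \<le> 1 + s^2"
proof -
  have "E (\<lambda>k. (v k - s)^2 + 2 * s * v k) = E (\<lambda>k. (v k - s)^2) + 2 * s * E v"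
    using E_v_linear[of "\<lambda>x. (x - s)^2" "2 * s" "\<lambda>x. x"] by simp
  then have "E (\<lambda>k. (v k - s)^2 + 2 * s * v k) \<le> 1 + 2 * s * s"
    using E_v_centered_2 E_v by simp
  moreover have "E (\<lambda>k. (v k)^2 + (s^2) * 1) = E (\<lambda>k. (v k)^2) + s^2 * E (\<lambda>k. 1)"
    using E_v_linear[of "\<lambda>x. x^2" "s^2" "\<lambda>x. 1"] by simp
  moreover have "(\<lambda>k. (v k - s)^2 + 2 * s * v k) = (\<lambda>k. (v k)^2 + (s^2) * 1)"
    by (auto simp: power2_eq_square algebra_simps)
  ultimately show ?thesis by (simp add: power2_eq_square)
qed

text \<open>Here \<phi> is \<open>x^2\<close>. The gain over the centered bounds is the factor
  \<open>s\<close> on the right, which matters for small \<open>s\<close>.\<close>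

lemma E_v_cube: "E (\<lambda>k. (v k)^3) \<le> s * E (\<lambda>k. (v k)^2) + 2 * s"
proof -
  have "E (\<lambda>k. (v k - s) * (v k)^2) = E (\<lambda>k. sqrt R * ((v k)^2 - (max 0 (v k - dl))^2))"
    by (rule stein)
  also have "\<dots> \<le> E (\<lambda>k. 0 + 2 * v k)"
  proof (rule E_mono[of "\<lambda>x. sqrt R * (x^2 - (max 0 (x - dl))^2)" "\<lambda>x. 0 + 2 * x"])
    fix x :: real assume x: "0 \<le> x"
    have "x^2 - (max 0 (x - dl))^2 \<le> dl * (2 * x)"
    proof (cases "x \<le> dl")
      case True
      then have "x * x \<le> dl * x" "0 \<le> dl * x" using x dl_pos by (auto intro: mult_right_mono)
      then show ?thesis using True by (simp add: power2_eq_square)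
    qed (simp add: power2_eq_square algebra_simps)
    then have "sqrt R * (x^2 - (max 0 (x - dl))^2) \<le> sqrt R * (dl * (2 * x))"
      using R1 by (intro mult_left_mono) auto
    also have "\<dots> = 2 * x" using dl_sqrt by (simp add: mult.assoc[symmetric])
    finally show "sqrt R * (x^2 - (max 0 (x - dl))^2) \<le> 0 + 2 * x" by simp
  qed
  also have "\<dots> = 2 * s" using E_v by simp
  finally have "E (\<lambda>k. (v k - s) * (v k)^2) \<le> 2 * s" .
  moreover have "(\<lambda>k. (v k - s) * (v k)^2) = (\<lambda>k. (v k)^3 + (- s) * (v k)^2)"
    by (auto simp: power2_eq_square power3_eq_cube algebra_simps)
  moreover have "E (\<lambda>k. (v k)^3 + (- s) * (v k)^2) = E (\<lambda>k. (v k)^3) + (- s) * E (\<lambda>k. (v k)^2)"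
    by (rule E_v_linear)
  ultimately show ?thesis by simp
qed

text \<open>Here \<phi> is \<open>min x 1\<close>. For \<open>0 < v k \<le> 1\<close> one has
  \<open>v k \<ge> dl\<close>, so its scaled increment is exactly 1; the event
  \<open>v k > 1\<close> is left to Markov's inequality. Each of the two parts costs
  \<open>E v = s\<close>.\<close>

lemma prob_less_n: "E (\<lambda>k. indicator {..<n} k) \<le> 2 * s"
proof -
  have "E (\<lambda>k. (v k - s) * min (v k) 1) = E (\<lambda>k. sqrt R * (min (v k) 1 - min (max 0 (v k - dl)) 1))"
    by (rule stein)
  moreover have "E (\<lambda>k. indicator {..<n} k) \<le> E (\<lambda>k. sqrt R * (min (v k) 1 - min (max 0 (v k - dl)) 1) + 1 * (if v k > 1 then v k else 0))"
  proof (rule E_mono_k[where \<psi>' = "\<lambda>x. 1"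
      and \<psi> = "\<lambda>x. sqrt R * (min x 1 - min (max 0 (x - dl)) 1) + 1 * (if x > 1 then x else 0)"])
    fix k
    show "indicator {..<n} k \<le> sqrt R * (min (v k) 1 - min (max 0 (v k - dl)) 1) + 1 * (if v k > 1 then v k else 0)"
    proof (cases "v k > 1")
      case True
      have "0 \<le> sqrt R * (min (v k) 1 - min (max 0 (v k - dl)) 1)"
        using R1 dl_pos v_nonneg[of k] by (intro mult_nonneg_nonneg) auto
      then show ?thesis using True by (simp add: indicator_def)
    next
      case False
      show ?thesis
      proof (cases "k < n")
        case True
        then show ?thesis using False v_ge_dl[OF True] dl_sqrt dl_pos by simp
      qed (use v_eq_0[of k] dl_pos in simp)
    qed
  qed (simp add: indicator_def)
  moreover have "E (\<lambda>k. sqrt R * (min (v k) 1 - min (max 0 (v k - dl)) 1) + 1 * (if v k > 1 then v k else 0))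
     = E (\<lambda>k. sqrt R * (min (v k) 1 - min (max 0 (v k - dl)) 1)) + 1 * E (\<lambda>k. if v k > 1 then v k else 0)"
    by (rule E_v_linear[of "\<lambda>x. sqrt R * (min x 1 - min (max 0 (x - dl)) 1)" 1 "\<lambda>x. if x > 1 then x else 0"])
  moreover have "E (\<lambda>k. if v k > 1 then v k else 0) \<le> E v"
    by (rule E_mono[of "\<lambda>x. if x > 1 then x else 0" "\<lambda>x. x"]) auto
  moreover have "E (\<lambda>k. (v k - s) * min (v k) 1) \<le> E v"
  proof (rule E_mono[of "\<lambda>x. (x - s) * min x 1" "\<lambda>x. x"])
    fix x :: real assume "0 \<le> x"
    then have "x * min x 1 \<le> x * 1" by (intro mult_left_mono) auto
    moreover have "0 \<le> s * min x 1" using s_pos \<open>0 \<le> x\<close> by simp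
    ultimately show "(x - s) * min x 1 \<le> x" by (simp add: left_diff_distrib)
  qed
  ultimately show ?thesis using E_v by linarith
qed

text \<open>State \<open>n\<close> is included because a cell error is charged to the right end of
  its cell. It at most doubles the bound: since \<open>R < n\<close>, detailed balance gives
  \<open>pmf p n \<le> pmf p (n - 1)\<close>.\<close>

lemma prob_le_n: "E (\<lambda>k. indicator {..n} k) \<le> 4 * s"
proof -
  obtain j where j: "n = Suc j" using R1 Rn by (cases n) auto
  have "pmf p n * R \<le> pmf p n * real n" using Rn by (intro mult_left_mono) auto
  also have "\<dots> = pmf p j * R" using balance[of j] j by (simp add: mult.commute)
  finally have "pmf p n \<le> pmf p j" using R1 by simp
  also have "\<dots> = E (indicator {j})" by (simp add: measure_pmf_single)
  also have "\<dots> \<le> E (indicator {..<n})"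
    by (simp, intro measure_pmf.finite_measure_mono) (use j in auto)
  finally have "pmf p n \<le> 2 * s" using prob_less_n by simp
  moreover have "E (indicator {..n}) = E (indicator {..<n}) + pmf p n"
  proof -
    have "measure_pmf.prob p ({..<n} \<union> {n}) = measure_pmf.prob p {..<n} + measure_pmf.prob p {n}"
      by (rule measure_pmf.finite_measure_Union) auto
    moreover have "{..<n} \<union> {n} = {..n}" by auto
    ultimately show ?thesis by (simp add: measure_pmf_single)
  qed
  ultimately show ?thesis using prob_less_n by simp
qed

text \<open>The weight \<open>1 + \<bar>grid k\<bar>^3\<close> is the relative error of a cell to
  the left of \<open>s\<close>, and the factor \<open>min 1 s\<close> will compensate the
  \<open>1 / s\<close> in the bound on \<open>g\<close>. For \<open>s > 1\<close> the fourth moment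
  suffices, with 2 + 7 = 9. For \<open>s \<le> 1\<close> the summand is dominated by an indicator
  and a cube that are both of order \<open>s\<close>: 5 * 4 + 4 * (2 + 2) = 36.\<close>

lemma third_moment_left: "(\<Sum>k\<le>n. pmf p k * (1 + \<bar>grid k\<bar>^3)) \<le> 36 * min 1 s"
proof -
  let ?f = "\<lambda>k. indicator {..n} k * (1 + \<bar>v k - s\<bar>^3)"
  have sum_eq: "(\<Sum>k\<le>n. pmf p k * (1 + \<bar>grid k\<bar>^3)) = E ?f"
  proof -
    have "E ?f = (\<Sum>k\<le>n. ?f k * pmf p k)"
      by (rule integral_measure_pmf_real) (auto split: split_indicator_asm)
    also have "\<dots> = (\<Sum>k\<le>n. pmf p k * (1 + \<bar>grid k\<bar>^3))"
      by (intro sum.cong) (auto simp: grid_v abs_minus_commute)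
    finally show ?thesis by simp
  qed
  have le9: "E ?f \<le> 9"
  proof -
    have "E ?f \<le> E (\<lambda>k. 2 + 1 * (v k - s)^4)"
    proof (rule E_mono_k[where \<psi>' = "\<lambda>x. 1 + \<bar>x - s\<bar>^3" and \<psi> = "\<lambda>x. 2 + 1 * (x - s)^4"])
      fix k
      have "\<bar>x\<bar>^3 \<le> 1 + x^4" for x :: real
      proof (cases "\<bar>x\<bar> \<le> 1")
        case True
        then have "\<bar>x\<bar>^3 \<le> 1" by (simp add: power_le_one)
        moreover have "0 \<le> x^4" by simp
        ultimately show ?thesis by linarith
      next
        case False
        then have "\<bar>x\<bar>^3 \<le> \<bar>x\<bar>^4" by (intro power_increasing) auto
        then show ?thesis by simp
      qed
      from this[of "v k - s"] show "?f k \<le> 2 + 1 * (v k - s)^4" by (auto simp: indicator_def)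
    qed (auto simp: indicator_def)
    also have "\<dots> \<le> 9"
      using E_v_linear[of "\<lambda>x. 2" 1 "\<lambda>x. (x - s)^4"] E_v_centered_4 by simp
    finally show ?thesis .
  qed
  show ?thesis
  proof (cases "s \<le> 1")
    case False
    then show ?thesis using sum_eq le9 by simp
  next
    case True
    have ind: "integrable (measure_pmf p) (indicator {..n} :: nat \<Rightarrow> real)"
      by (intro measure_pmf.integrable_const_bound[where B = 1]) (auto simp: indicator_def)
    have "E ?f \<le> E (\<lambda>k. 5 * indicator {..n} k + 4 * (v k)^3)"
    proof (rule integral_mono)
      show "integrable (measure_pmf p) (\<lambda>k. 5 * indicator {..n} k + 4 * (v k)^3)"
        using integrable_v[of "\<lambda>x. 4 * x^3"] ind by (intro Bochner_Integration.integrable_add) auto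
      show "integrable (measure_pmf p) ?f"
        by (rule Bochner_Integration.integrable_bound[OF integrable_v[of "\<lambda>x. 1 + \<bar>x - s\<bar>^3"]])
           (auto simp: indicator_def)
      show "?f k \<le> 5 * indicator {..n} k + 4 * (v k)^3" for k
      proof -
        define x where "x = v k"
        have x: "0 \<le> x" by (simp add: x_def v_nonneg)
        have "\<bar>x - s\<bar>^3 \<le> (x + 1)^3" using x True s_pos by (intro power_mono) auto
        also have "\<dots> \<le> 4 * x^3 + 4"
        proof -
          have "0 \<le> 3 * (x + 1) * (x - 1)^2" using x by simp
          then show ?thesis by (simp add: power2_eq_square power3_eq_cube algebra_simps)
        qed
        finally show ?thesis using x by (auto simp: indicator_def x_def)
      qed
    qed
    also have "\<dots> = 5 * E (indicator {..n}) + 4 * E (\<lambda>k. (v k)^3)"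
      using integrable_v[of "\<lambda>x. 4 * x^3"]
      by (subst Bochner_Integration.integral_add)
         (use ind in auto)
    also have "\<dots> \<le> 20 * s + 4 * (s * 2 + 2 * s)"
    proof -
      have "s^2 \<le> 1" using True s_pos by (simp add: power_le_one)
      then have "s * E (\<lambda>k. (v k)^2) \<le> s * 2"
        using E_v_square s_pos by (intro mult_left_mono) auto
      then have "E (\<lambda>k. (v k)^3) \<le> s * 2 + 2 * s" using E_v_cube by linarith
      then show ?thesis using prob_le_n by simp
    qed
    finally show ?thesis using True sum_eq by simp
  qed
qed

text \<open>Chebyshev's inequality: \<open>v k = 0\<close> for \<open>k \<ge> n\<close>, so
  \<open>(v k - s)^2\<close> equals \<open>s^2\<close> there. It will pay for the cells to the right
  of \<open>s\<close>.\<close>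

lemma s_prob_ge_n: "s * measure_pmf.prob p {n..} \<le> 1"
proof (cases "s \<le> 1")
  case True
  then have "s * measure_pmf.prob p {n..} \<le> 1 * 1" using s_pos by (intro mult_mono) auto
  then show ?thesis by simp
next
  case False
  have "s * measure_pmf.prob p {n..} \<le> s^2 * measure_pmf.prob p {n..}"
    using False by (intro mult_right_mono) (auto simp: power2_eq_square)
  also have "\<dots> = E (\<lambda>k. s^2 * indicator {n..} k)" by simp
  also have "\<dots> \<le> E (\<lambda>k. (v k - s)^2)"
    by (rule E_mono_k[where \<psi>' = "\<lambda>x. s^2"]) (auto simp: indicator_def v_eq_0)
  also have "\<dots> \<le> 1" by (rule E_v_centered_2)
  finally show ?thesis .
qed

section \<open>Geometric tail and integrability\<close>

lemma pmf_tail: "pmf p (n + j) = pmf p n * (R / real n)^j"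
proof (induction j)
  case (Suc j)
  have "real n * pmf p (n + Suc j) = R * pmf p (n + j)" using balance[of "n + j"] by simp
  then have "pmf p (n + Suc j) = (R / real n) * pmf p (n + j)" using Rn R1 by (simp add: field_simps)
  then show ?case using Suc by simp
qed simp

lemma summable_first_moment: "summable (\<lambda>k. pmf p k * real k)"
proof -
  have r: "norm (R / real n) < 1" using R1 Rn by simp
  have "summable (\<lambda>j. of_nat (Suc j) * (R / real n)^j)"
    using geometric_deriv_sums[OF r] by (rule sums_summable)
  moreover have "summable (\<lambda>j. (R / real n)^j)" using r by (rule summable_geometric)
  ultimately have "summable (\<lambda>j. pmf p n * (of_nat (Suc j) * (R / real n)^j + (real n - 1) * (R / real n)^j))"
    by (intro summable_mult summable_add)
  also have "(\<lambda>j. pmf p n * (of_nat (Suc j) * (R / real n)^j + (real n - 1) * (R / real n)^j))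
     = (\<lambda>j. pmf p (j + n) * real (j + n))"
  proof
    fix j
    have "pmf p (j + n) * real (j + n) = pmf p n * (R / real n)^j * (real n + real j)"
      by (simp only: add.commute[of j n] pmf_tail of_nat_add)
    then show "pmf p n * (of_nat (Suc j) * (R / real n)^j + (real n - 1) * (R / real n)^j)
        = pmf p (j + n) * real (j + n)"
      unfolding of_nat_Suc by (metis (no_types, opaque_lifting) add.commute add_diff_cancel_left'
        diff_add_eq distrib_right mult.assoc mult.commute)
  qed
  finally show ?thesis by (subst (asm) summable_iff_shift)
qed

lemma integrable_affine_bounded:
  assumes "\<And>k. \<bar>f k\<bar> \<le> a + b * real k"
  shows "integrable (measure_pmf p) f"
proof (rule nat_pmf_integrable, rule summable_comparison_test')
  show "summable (\<lambda>k. a * pmf p k + b * (pmf p k * real k))"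
    using nat_pmf_expectation_sums[of p "\<lambda>_. 1"] summable_first_moment
    by (intro summable_add summable_mult) (auto simp: sums_iff)
  show "norm (pmf p k * \<bar>f k\<bar>) \<le> a * pmf p k + b * (pmf p k * real k)" for k
    using mult_left_mono[OF assms, of "pmf p k" k] by (simp add: algebra_simps)
qed

end

section \<open>The Stein equation of the diffusion\<close>

lemma increment_bound:
  fixes M V f F :: "real \<Rightarrow> real"
  assumes ab: "a \<le> b"
    and M: "\<And>x. a \<le> x \<Longrightarrow> x \<le> b \<Longrightarrow> (M has_real_derivative f x) (at x)"
    and V: "\<And>x. a \<le> x \<Longrightarrow> x \<le> b \<Longrightarrow> (V has_real_derivative F x) (at x)"
    and le: "\<And>x. a \<le> x \<Longrightarrow> x \<le> b \<Longrightarrow> \<bar>f x\<bar> \<le> F x"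
  shows "\<bar>M b - M a\<bar> \<le> V b - V a"
proof -
  have "V a - M a \<le> V b - M b"
  proof (rule DERIV_nonneg_imp_nondecreasing[OF ab])
    fix x assume x: "a \<le> x" "x \<le> b"
    then have "((\<lambda>x. V x - M x) has_real_derivative F x - f x) (at x)" using M V by (intro DERIV_diff)
    then show "\<exists>y. ((\<lambda>x. V x - M x) has_real_derivative y) (at x) \<and> 0 \<le> y"
      using le[OF x] by (intro exI[of _ "F x - f x"]) auto
  qed
  moreover have "V a + M a \<le> V b + M b"
  proof (rule DERIV_nonneg_imp_nondecreasing[OF ab])
    fix x assume x: "a \<le> x" "x \<le> b"
    then have "((\<lambda>x. V x + M x) has_real_derivative F x + f x) (at x)" using M V by (intro DERIV_add)
    then show "\<exists>y. ((\<lambda>x. V x + M x) has_real_derivative y) (at x) \<and> 0 \<le> y"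
      using le[OF x] by (intro exI[of _ "F x + f x"]) auto
  qed
  ultimately show ?thesis by linarith
qed

text \<open>As the left end point tends to minus infinity, \<open>M\<close> vanishes and
  \<open>V\<close> is discarded by its sign. Estimating an improper integral is thus reduced to
  exhibiting an explicit \<open>V\<close>.\<close>

lemma comparison_at_bot:
  fixes M V f F :: "real \<Rightarrow> real"
  assumes M: "\<And>x. x \<le> b \<Longrightarrow> (M has_real_derivative f x) (at x)"
    and V: "\<And>x. x \<le> b \<Longrightarrow> (V has_real_derivative F x) (at x)"
    and le: "\<And>x. x \<le> b \<Longrightarrow> \<bar>f x\<bar> \<le> F x" and V0: "\<And>x. x \<le> b \<Longrightarrow> 0 \<le> V x"
    and lim: "(M \<longlongrightarrow> 0) at_bot"
  shows "\<bar>M b\<bar> \<le> V b"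
proof -
  have "((\<lambda>a. V b + \<bar>M a\<bar>) \<longlongrightarrow> V b + \<bar>0\<bar>) at_bot" by (intro tendsto_intros lim)
  moreover have "\<forall>\<^sub>F a in at_bot. \<bar>M b\<bar> \<le> V b + \<bar>M a\<bar>"
    using eventually_le_at_bot[of b]
  proof eventually_elim
    case (elim a)
    then have "\<bar>M b - M a\<bar> \<le> V b - V a" by (intro increment_bound[OF _ M V le]) auto
    then show ?case using V0[OF elim] by linarith
  qed
  ultimately show ?thesis by (auto intro: tendsto_lowerbound)
qed

lemma comparison_at_top:
  fixes M V f F :: "real \<Rightarrow> real"
  assumes M: "\<And>x. a \<le> x \<Longrightarrow> (M has_real_derivative f x) (at x)"
    and V: "\<And>x. a \<le> x \<Longrightarrow> (V has_real_derivative - F x) (at x)"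
    and le: "\<And>x. a \<le> x \<Longrightarrow> \<bar>f x\<bar> \<le> F x" and V0: "\<And>x. a \<le> x \<Longrightarrow> 0 \<le> V x"
    and lim: "(M \<longlongrightarrow> 0) at_top"
  shows "\<bar>M a\<bar> \<le> V a"
proof -
  have "((\<lambda>b. V a + \<bar>M b\<bar>) \<longlongrightarrow> V a + \<bar>0\<bar>) at_top" by (intro tendsto_intros lim)
  moreover have "\<forall>\<^sub>F b in at_top. \<bar>M a\<bar> \<le> V a + \<bar>M b\<bar>"
    using eventually_ge_at_top[of a]
  proof eventually_elim
    case (elim b)
    have "\<bar>M b - M a\<bar> \<le> - V b - (- V a)"
      by (rule increment_bound[OF elim, where V = "\<lambda>x. - V x" and F = F and f = f])
         (auto intro!: M le derivative_eq_intros V)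
    then show ?case using V0[OF elim] by linarith
  qed
  ultimately show ?thesis by (auto intro: tendsto_lowerbound)
qed

lemma continuous_antiderivative:
  fixes f :: "real \<Rightarrow> real"
  assumes "continuous_on UNIV f"
  obtains F where "\<And>x. (F has_real_derivative f x) (at x)"
proof -
  have "\<exists>F. \<forall>x::real. -\<infinity> < ereal x \<longrightarrow> ereal x < \<infinity> \<longrightarrow> (F has_vector_derivative f x) (at x)"
    using assms by (intro einterval_antiderivative) (auto simp: continuous_on_eq_continuous_at)
  then show ?thesis using that by (auto simp: has_real_derivative_iff_has_vector_derivative)
qed

lemma has_bochner_integral_FTC_line:
  fixes f F :: "real \<Rightarrow> real"
  assumes F: "\<And>x. (F has_real_derivative f x) (at x)" and f: "continuous_on UNIV f" and "a \<le> b"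
  shows "has_bochner_integral lborel (\<lambda>x. f x * indicator {a..b} x) (F b - F a)"
  using f by (intro has_bochner_integral_FTC_Icc_real \<open>a \<le> b\<close> F)
    (simp add: continuous_on_eq_continuous_at)

lemma integrable_bounded_increments:
  fixes f F :: "real \<Rightarrow> real"
  assumes F: "\<And>x. (F has_real_derivative f x) (at x)" and f: "continuous_on UNIV f"
    and nonneg: "\<And>x. 0 \<le> f x" and K: "\<And>N::nat. F (real N) - F (- real N) \<le> K"
  shows "integrable lborel f" and "(\<integral>x. f x \<partial>lborel) \<le> K"
proof -
  have [measurable]: "f \<in> borel_measurable borel" using f by (rule borel_measurable_continuous_onI)
  let ?i = "\<lambda>(N::nat) x. f x * indicator {- real N..real N} x"
  have hbi: "has_bochner_integral lborel (?i N) (F (real N) - F (- real N))" for N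
    by (intro has_bochner_integral_FTC_line F f) auto
  have mono: "mono (\<lambda>N. ?i N x)" for x
    using nonneg[of x] by (auto simp: mono_def indicator_def)
  have int_mono: "incseq (\<lambda>N. \<integral>x. ?i N x \<partial>lborel)"
  proof (rule incseq_SucI, rule integral_mono)
    show "integrable lborel (?i N)" for N using hbi[of N] by (simp add: has_bochner_integral_iff)
    then show "integrable lborel (?i (Suc N))" for N .
    show "?i N x \<le> ?i (Suc N) x" for N x using monoD[OF mono[of x], of N "Suc N"] by linarith
  qed
  have bd: "(\<integral>x. ?i N x \<partial>lborel) \<le> K" for N
    using hbi[of N] K[of N] by (simp add: has_bochner_integral_iff)
  obtain L where L: "(\<lambda>N. \<integral>x. ?i N x \<partial>lborel) \<longlonglongrightarrow> L" "\<forall>N. (\<integral>x. ?i N x \<partial>lborel) \<le> L"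
    using incseq_convergent[OF int_mono] bd by blast
  have pt: "(\<lambda>N. ?i N x) \<longlonglongrightarrow> f x" for x
  proof (rule tendsto_eventually)
    obtain N0 :: nat where "\<bar>x\<bar> < real N0" using reals_Archimedean2 by blast
    then have "?i N x = f x" if "N \<ge> N0" for N using that by (auto simp: indicator_def)
    then show "\<forall>\<^sub>F N in sequentially. ?i N x = f x" by (auto simp: eventually_sequentially)
  qed
  have "has_bochner_integral lborel f L"
    by (rule has_bochner_integral_monotone_convergence[of _ ?i])
       (use hbi mono pt L in \<open>auto simp: has_bochner_integral_iff\<close>)
  moreover have "L \<le> K" using L(1) bd by (auto intro: LIMSEQ_le_const2)
  ultimately show "integrable lborel f" "(\<integral>x. f x \<partial>lborel) \<le> K" by (auto simp: has_bochner_integral_iff)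
qed

lemma increment_le_integral:
  fixes f F :: "real \<Rightarrow> real"
  assumes F: "\<And>x. (F has_real_derivative f x) (at x)" and f: "continuous_on UNIV f"
    and nonneg: "\<And>x. 0 \<le> f x" and int: "integrable lborel f" and ab: "a \<le> b"
  shows "F b - F a \<le> (\<integral>x. f x \<partial>lborel)"
proof -
  have hbi: "has_bochner_integral lborel (\<lambda>x. f x * indicator {a..b} x) (F b - F a)"
    by (intro has_bochner_integral_FTC_line F f ab)
  then have "F b - F a = (\<integral>x. f x * indicator {a..b} x \<partial>lborel)" by (simp add: has_bochner_integral_iff)
  also have "\<dots> \<le> (\<integral>x. f x \<partial>lborel)"
    by (rule integral_mono) (use hbi nonneg int in \<open>auto simp: has_bochner_integral_iff indicator_def\<close>)
  finally show ?thesis .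
qed

text \<open>\<open>M\<close> is the integral over \<open>{..x}\<close>, and the vanishing total
  integral supplies the limit at the other end. It will be the numerator of the Stein solution,
  which is estimated from both ends.\<close>

lemma antiderivative_vanishing_at_infinity:
  fixes f :: "real \<Rightarrow> real"
  assumes f: "continuous_on UNIV f" and int: "integrable lborel f" and zero: "(\<integral>x. f x \<partial>lborel) = 0"
  obtains M where "\<And>x. (M has_real_derivative f x) (at x)" "(M \<longlongrightarrow> 0) at_bot" "(M \<longlongrightarrow> 0) at_top"
proof -
  obtain F where F: "\<And>x. (F has_real_derivative f x) (at x)" using continuous_antiderivative[OF f] by blast
  have [measurable]: "f \<in> borel_measurable borel" using f by (rule borel_measurable_continuous_onI)
  define M where "M = (\<lambda>x. \<integral>y\<in>{..x}. f y \<partial>lborel)"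
  have M_diff: "M b - M a = F b - F a" if "a \<le> b" for a b
  proof -
    have s: "set_integrable lborel S f" if "S \<in> sets borel" for S
      using int that unfolding set_integrable_def by (intro integrable_mult_indicator) auto
    have hbi: "has_bochner_integral lborel (\<lambda>x. f x * indicator {a..b} x) (F b - F a)"
      by (intro has_bochner_integral_FTC_line F f that)
    have "(\<integral>y\<in>{..a} \<union> {a<..b}. f y \<partial>lborel) = M a + (\<integral>y\<in>{a<..b}. f y \<partial>lborel)"
      unfolding M_def by (rule set_integral_Un) (auto intro: s)
    moreover have "{..a} \<union> {a<..b} = {..b}" using that by auto
    moreover have "(\<integral>y\<in>{a<..b}. f y \<partial>lborel) = (\<integral>y\<in>{a..b}. f y \<partial>lborel)"
      unfolding set_lebesgue_integral_def
      by (rule integral_cong_AE)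
         (use AE_lborel_singleton[of a] in \<open>auto elim!: eventually_mono split: split_indicator\<close>)
    moreover have "\<dots> = F b - F a" using hbi by (simp add: has_bochner_integral_iff set_lebesgue_integral_def mult.commute)
    ultimately show ?thesis by (simp add: M_def)
  qed
  have M_eq: "M x = M 0 + (F x - F 0)" for x using M_diff[of 0 x] M_diff[of x 0] by (cases "x \<ge> 0") auto
  show thesis
  proof
    show "(M has_real_derivative f x) (at x)" for x
      by (subst M_eq[abs_def]) (auto intro!: derivative_eq_intros F)
    show "(M \<longlongrightarrow> 0) at_bot"
    proof -
      have "((\<lambda>t. \<integral>y\<in>{..- t}. f y \<partial>lborel) \<longlongrightarrow> (\<integral>y. 0 \<partial>(lborel :: real measure))) at_top"
        unfolding set_lebesgue_integral_def
      proof (rule integral_dominated_convergence_at_top[where w = "\<lambda>y. \<bar>f y\<bar>"])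
        have "((\<lambda>t. indicator {..- t} y *\<^sub>R f y) \<longlongrightarrow> 0) at_top" for y
        proof (rule tendsto_eventually)
          show "\<forall>\<^sub>F t in at_top. indicator {..- t} y *\<^sub>R f y = 0"
            using eventually_gt_at_top[of "- y"] by eventually_elim simp
        qed
        then show "AE y in lborel. ((\<lambda>t. indicator {..- t} y *\<^sub>R f y) \<longlongrightarrow> 0) at_top" by simp
      qed (use int in \<open>auto simp: indicator_def\<close>)
      then show ?thesis by (simp add: M_def filterlim_at_bot_mirror)
    qed
    show "(M \<longlongrightarrow> 0) at_top"
      using tendsto_integral_at_top[OF _ int] zero by (simp add: M_def set_lebesgue_integral_def)
  qed
qed

text \<open>The diffusion coefficient for \<open>mu = 1\<close>. The indicator has become a maximum:
  the factor behind it changes sign exactly at \<open>- sqrt R\<close>, so the coefficient is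
  continuous.\<close>

definition var_coeff :: "real \<Rightarrow> real \<Rightarrow> real \<Rightarrow> real" where
  "var_coeff s dl x = 1 + max 0 (1 + dl * min x s)"

text \<open>With \<open>u = 2 * m / A\<close> as unnormalized stationary density,
  \<open>m_ode\<close> is the zero-flux equation \<open>(A * u / 2)' = b * u\<close>. Everything
  below follows from this equation and positivity; no formula for \<open>m\<close> is used.\<close>

locale stein_diffusion =
  fixes s dl :: real and m :: "real \<Rightarrow> real"
  assumes s_pos: "0 < s" and dl_pos: "0 < dl" and dl_le_1: "dl \<le> 1"
    and m_pos: "\<And>x. 0 < m x"
    and m_ode: "\<And>x. (m has_real_derivative - min x s * (2 * m x / var_coeff s dl x)) (at x)"
begin

abbreviation A :: "real \<Rightarrow> real" where "A \<equiv> var_coeff s dl"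
definition u :: "real \<Rightarrow> real" where "u x = 2 * m x / A x"

lemma m_deriv: "(m has_real_derivative - min x s * u x) (at x)"
  using m_ode by (simp add: u_def)

lemma A_ge_1: "1 \<le> A x" and A_le_2: "x \<le> 0 \<Longrightarrow> A x \<le> 2"
  and A_tail: "s \<le> x \<Longrightarrow> A x = 2 + dl * s"
proof -
  show "1 \<le> A x" by (simp add: var_coeff_def)
  show "A x \<le> 2" if "x \<le> 0"
  proof -
    have "dl * min x s \<le> 0" using that s_pos dl_pos by (simp add: mult_le_0_iff)
    then show ?thesis by (simp add: var_coeff_def)
  qed
  show "A x = 2 + dl * s" if "s \<le> x" using that s_pos dl_pos by (simp add: var_coeff_def min_def)
qed

lemma u_pos: "0 < u x" and u_le: "u x \<le> 2 * m x" and m_le_u: "x \<le> 0 \<Longrightarrow> m x \<le> u x"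
proof -
  show "0 < u x" using m_pos[of x] A_ge_1[of x] by (simp add: u_def)
  show "u x \<le> 2 * m x" using m_pos[of x] A_ge_1[of x] by (simp add: u_def divide_simps)
  show "m x \<le> u x" if "x \<le> 0"
    using m_pos[of x] A_ge_1[of x] mult_right_mono[OF A_le_2[OF that], of "m x"]
    by (simp add: u_def field_simps)
qed

lemma cont_m: "continuous_on UNIV m"
  using m_deriv by (meson DERIV_isCont continuous_at_imp_continuous_on)

lemma cont_u: "continuous_on UNIV u"
proof -
  have "A x \<noteq> 0" for x using A_ge_1[of x] by simp
  moreover have "continuous_on UNIV A" unfolding var_coeff_def by (intro continuous_intros)
  ultimately show ?thesis unfolding u_def by (intro continuous_intros cont_m) auto
qed

section \<open>Shape of \<open>m\<close>: peak at 0, Gaussian lower bound, exponential tail\<close>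

lemma m_mono_left: assumes "a \<le> b" "b \<le> 0" shows "m a \<le> m b"
proof (rule DERIV_nonneg_imp_nondecreasing[OF assms(1)])
  fix x assume "x \<le> b" with assms(2)
  show "\<exists>y. (m has_real_derivative y) (at x) \<and> 0 \<le> y"
    using m_deriv[of x] u_pos[of x] s_pos by (intro exI[of _ "- min x s * u x"]) (simp add: mult_le_0_iff)
qed

lemma m_antimono_right: assumes "a \<le> b" "0 \<le> a" shows "m b \<le> m a"
proof (rule DERIV_nonpos_imp_nonincreasing[OF assms(1)])
  fix x assume "a \<le> x" with assms(2)
  show "\<exists>y. (m has_real_derivative y) (at x) \<and> y \<le> 0"
    using m_deriv[of x] u_pos[of x] s_pos by (intro exI[of _ "- min x s * u x"]) auto
qed

lemma m_le_m0: "m x \<le> m 0"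
  using m_mono_left[of x 0] m_antimono_right[of 0 x] by (cases "x \<le> 0") auto

text \<open>The logarithmic derivative of \<open>m x * exp (x^2)\<close> is
  \<open>2 * x * (1 - 1 / A x)\<close>, which has the sign of \<open>x\<close> because
  \<open>A \<ge> 1\<close>; so this product is smallest at 0.\<close>

lemma m_ge_gaussian:
  assumes "x \<le> s"
  shows "m 0 * exp (- (x^2)) \<le> m x"
proof -
  let ?k = "\<lambda>x. m x * exp (x^2)" and ?k' = "\<lambda>x. 2 * m x * exp (x^2) * (x * (1 - 1 / A x))"
  have deriv: "(?k has_real_derivative ?k' y) (at y)" if "y \<le> s" for y
  proof -
    have "(?k has_real_derivative (- min y s * u y) * exp (y^2) + m y * (exp (y^2) * (2 * y))) (at y)"
      by (rule derivative_eq_intros m_deriv | simp)+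
    moreover have "(- min y s * u y) * exp (y^2) + m y * (exp (y^2) * (2 * y)) = ?k' y"
      using that A_ge_1[of y] by (simp add: u_def min_def field_simps)
    ultimately show ?thesis by simp
  qed
  have A1: "0 \<le> 1 - 1 / A y" for y using A_ge_1[of y] by (simp add: field_simps)
  have "?k 0 \<le> ?k x"
  proof (cases "0 \<le> x")
    case True
    show ?thesis
    proof (rule DERIV_nonneg_imp_nondecreasing[OF True])
      fix y assume y: "0 \<le> y" "y \<le> x"
      then have "0 \<le> ?k' y" using A1[of y] m_pos[of y] by simp
      then show "\<exists>d. (?k has_real_derivative d) (at y) \<and> 0 \<le> d" using deriv[of y] y assms by auto
    qed
  next
    case False
    show ?thesis
    proof (rule DERIV_nonpos_imp_nonincreasing[of x 0])
      fix y assume y: "x \<le> y" "y \<le> 0"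
      then have "y * (1 - 1 / A y) \<le> 0" using A1[of y] by (simp add: mult_le_0_iff)
      then have "?k' y \<le> 0" using m_pos[of y] by (simp add: mult_le_0_iff)
      then show "\<exists>d. (?k has_real_derivative d) (at y) \<and> d \<le> 0" using deriv[of y] y s_pos by auto
    qed (use False in auto)
  qed
  then show ?thesis by (simp add: exp_minus field_simps)
qed

lemma m_near_0:
  assumes "x \<le> s" "\<bar>x\<bar> \<le> 1"
  shows "m 0 \<le> 3 * m x"
proof -
  have "exp (- 1) \<le> exp (- (x^2))" using assms(2) by (simp add: abs_square_le_1)
  then have "m 0 * exp (- 1) \<le> m x"
    using m_ge_gaussian[OF assms(1)] mult_left_mono[of "exp (-1)" "exp (- (x^2))" "m 0"] m_pos[of 0] by linarith
  then have "m 0 \<le> m x * exp 1" by (simp add: exp_minus field_simps)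
  also have "\<dots> \<le> m x * 3" using exp_le m_pos[of x] by (intro mult_left_mono) auto
  finally show ?thesis by simp
qed

lemma m_tail:
  assumes "s \<le> x"
  shows "m x = m s * exp (- (2 * s / (2 + dl * s)) * (x - s))"
proof -
  define r where "r = 2 * s / (2 + dl * s)"
  have "((\<lambda>x. m x * exp (r * (x - s))) has_real_derivative 0) (at y)" if "s \<le> y" for y
  proof -
    have "((\<lambda>x. m x * exp (r * (x - s))) has_real_derivative
       (- min y s * u y) * exp (r * (y - s)) + m y * (exp (r * (y - s)) * r)) (at y)"
      by (rule derivative_eq_intros m_deriv | simp)+
    moreover have "(- min y s * u y) * exp (r * (y - s)) + m y * (exp (r * (y - s)) * r) = 0"
      using that by (simp add: u_def r_def A_tail)
    ultimately show ?thesis by (rule DERIV_cong)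
  qed
  then have "m x * exp (r * (x - s)) = m s * exp (r * (s - s))"
    using assms by (intro antisym DERIV_nonneg_imp_nondecreasing[OF assms, of "\<lambda>x. m x * exp (r * (x - s))"]
      DERIV_nonpos_imp_nonincreasing[OF assms, of "\<lambda>x. m x * exp (r * (x - s))"]) auto
  then have "m x * exp (r * (x - s)) = m s" by simp
  then have "m x = m s / exp (r * (x - s))" by (simp add: nonzero_eq_divide_eq)
  then show ?thesis unfolding r_def by (simp add: exp_minus divide_inverse)
qed

lemma tail_rate_pos: "0 < 2 * s / (2 + dl * s)"
  using s_pos dl_pos by (simp add: add_pos_pos)

lemma m_lim: "(m \<longlongrightarrow> 0) at_top"
proof -
  define r where "r = 2 * s / (2 + dl * s)"
  have r: "0 < r" using tail_rate_pos by (simp add: r_def)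
  have top: "filterlim (\<lambda>x. r * (x - s)) at_top at_top"
  proof (rule filterlim_tendsto_pos_mult_at_top[OF tendsto_const r])
    have "filterlim (\<lambda>x. - s + x) at_top at_top"
      by (rule filterlim_tendsto_add_at_top[OF tendsto_const filterlim_ident])
    then show "filterlim (\<lambda>x. x - s) at_top at_top" by simp
  qed
  have decay: "((\<lambda>x. exp (- (r * (x - s)))) \<longlongrightarrow> 0) at_top"
    using filterlim_compose[OF exp_at_bot filterlim_compose[OF filterlim_uminus_at_bot_at_top top]] by simp
  have m_eq: "\<forall>\<^sub>F x in at_top. m s * exp (- (r * (x - s))) = m x"
    using eventually_ge_at_top[of s]
  proof eventually_elim
    case (elim x)
    then show ?case unfolding r_def using m_tail[OF elim] by simp
  qed
  have "((\<lambda>x. m s * exp (- (r * (x - s)))) \<longlongrightarrow> m s * 0) at_top"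
    by (intro tendsto_intros decay)
  then show ?thesis using m_eq by (auto intro: Lim_transform_eventually)
qed

text \<open>The constant for which \<open>(y / s + c) * m y\<close> is an antiderivative of
  \<open>- (y * u y)\<close> to the right of \<open>s\<close>: there
  \<open>c * s * u y = m y / s\<close>.\<close>

definition c :: real where "c = (2 + dl * s) / (2 * s^2)"

lemma c_pos: "0 < c" using s_pos dl_pos by (simp add: c_def add_pos_pos)

lemma tail_potential_deriv:
  assumes "s \<le> y"
  shows "((\<lambda>y. (y / s + c) * m y) has_real_derivative - (y * u y)) (at y)"
proof -
  have "((\<lambda>y. y / s + c) has_real_derivative 1 / s) (at y)"
    using s_pos by (auto intro!: derivative_eq_intros simp: field_simps)
  then have "((\<lambda>y. (y / s + c) * m y) has_real_derivative (1 / s) * m y + (- min y s * u y) * (y / s + c)) (at y)"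
    by (rule DERIV_mult[OF _ m_deriv])
  moreover have "(1 / s) * m y + (- min y s * u y) * (y / s + c) = - (y * u y)"
  proof -
    have pos: "2 + dl * s > 0" using s_pos dl_pos by (simp add: add_pos_pos)
    have "c * s * u y = m y / s" using assms s_pos pos
      by (simp add: c_def u_def A_tail power2_eq_square divide_simps)
    moreover have "min y s = s" using assms by simp
    ultimately show ?thesis using s_pos by (simp add: algebra_simps)
  qed
  ultimately show ?thesis by simp
qed

text \<open>An explicit antiderivative is at hand on each of three pieces: \<open>m\<close> on the
  left of 0, \<open>- m\<close> on \<open>[0, s]\<close> and the tail potential beyond
  \<open>s\<close>. Their increments sum to at most \<open>m 0 + m 0 + c * m 0\<close>.\<close>

lemma integrable_abs_u: "integrable lborel (\<lambda>y. \<bar>y\<bar> * u y)"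
  and integral_abs_u: "(\<integral>y. \<bar>y\<bar> * u y \<partial>lborel) \<le> (2 + c) * m 0"
proof -
  have cont: "continuous_on UNIV (\<lambda>y. \<bar>y\<bar> * u y)" by (intro continuous_intros cont_u)
  obtain F where F: "\<And>x. (F has_real_derivative \<bar>x\<bar> * u x) (at x)"
    using continuous_antiderivative[OF cont] by blast
  have left: "\<bar>F 0 - F x\<bar> \<le> m 0 - m x" if "x \<le> 0" for x
    by (rule increment_bound[OF that F m_deriv]) (use s_pos u_pos in \<open>auto simp: abs_mult less_imp_le min_def\<close>)
  have mid: "\<bar>F x - F 0\<bar> \<le> - m x - (- m 0)" if "0 \<le> x" "x \<le> s" for x
    by (rule increment_bound[OF that(1) F, where F = "\<lambda>y. min y s * u y" and V = "\<lambda>x. - m x"])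
       (use u_pos that in \<open>auto simp: abs_mult less_imp_le min_def intro!: derivative_eq_intros m_deriv\<close>)
  have right: "\<bar>F x - F s\<bar> \<le> - ((x / s + c) * m x) - (- ((s / s + c) * m s))" if "s \<le> x" for x
    by (rule increment_bound[OF that F, where F = "\<lambda>y. y * u y" and V = "\<lambda>y. - ((y / s + c) * m y)"])
       (use u_pos s_pos DERIV_minus[OF tail_potential_deriv] in \<open>auto simp: abs_mult less_imp_le\<close>)
  have "F (real N) - F (- real N) \<le> (2 + c) * m 0" for N
  proof -
    have 1: "F 0 - F (- real N) \<le> m 0" using left[of "- real N"] m_pos[of "- real N"] by simp
    have cm0: "0 \<le> c * m 0" using c_pos m_pos[of 0] by simp
    have "F (real N) - F 0 \<le> (1 + c) * m 0"
    proof (cases "real N \<le> s")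
      case True
      then show ?thesis using mid[of "real N"] m_pos[of "real N"] cm0 by (simp add: distrib_right)
    next
      case False
      have "0 \<le> (real N / s + c) * m (real N)" using c_pos s_pos m_pos[of "real N"] by simp
      then have "F (real N) - F s \<le> m s + c * m s"
        using right[of "real N"] False s_pos by (simp add: distrib_right)
      moreover have "F s - F 0 \<le> m 0 - m s" using mid[of s] s_pos by simp
      moreover have "c * m s \<le> c * m 0" using c_pos m_le_m0[of s] by (intro mult_left_mono) auto
      ultimately show ?thesis by (simp add: distrib_right)
    qed
    then show ?thesis using 1 by (simp add: distrib_right)
  qed
  then show "integrable lborel (\<lambda>y. \<bar>y\<bar> * u y)" "(\<integral>y. \<bar>y\<bar> * u y \<partial>lborel) \<le> (2 + c) * m 0"
    using integrable_bounded_increments[OF F cont] u_pos by (auto simp: less_imp_le)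
qed

lemma u_measurable [measurable]: "u \<in> borel_measurable borel"
  using cont_u by (rule borel_measurable_continuous_onI)

lemma integrable_u: "integrable lborel u"
proof (rule Bochner_Integration.integrable_bound)
  show "integrable lborel (\<lambda>y. \<bar>y\<bar> * u y + 2 * m 0 * indicator {-1..1} y)"
    by (intro Bochner_Integration.integrable_add integrable_abs_u) auto
  show "AE x in lborel. norm (u x) \<le> norm (\<bar>x\<bar> * u x + 2 * m 0 * indicator {-1..1} x)"
  proof (intro AE_I2)
    fix x
    have "u x \<le> \<bar>x\<bar> * u x + 2 * m 0 * indicator {-1..1} x"
    proof (cases "\<bar>x\<bar> \<le> 1")
      case True
      then have "x \<in> {-1..1}" by auto
      moreover have "u x \<le> 2 * m 0" using u_le[of x] m_le_m0[of x] by linarith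
      moreover have "0 \<le> \<bar>x\<bar> * u x" using u_pos[of x] by simp
      ultimately show ?thesis by simp
    next
      case False
      then have "1 * u x \<le> \<bar>x\<bar> * u x" using u_pos[of x] by (intro mult_right_mono) auto
      then show ?thesis using m_pos[of 0] by (simp add: indicator_def)
    qed
    then show "norm (u x) \<le> norm (\<bar>x\<bar> * u x + 2 * m 0 * indicator {-1..1} x)" using u_pos[of x] by simp
  qed
qed simp

definition Z :: real where "Z = (\<integral>x. u x \<partial>lborel)"

text \<open>Two lower bounds on the mass: on \<open>[-1, 0]\<close> the density is at least
  \<open>m 0 / 3\<close>, and the tail beyond \<open>s\<close> has mass \<open>m s / s\<close> since
  \<open>m' = - s * u\<close> there. The second one turns the \<open>1 / s^2\<close> in
  \<open>c\<close> into \<open>1 / s\<close> when \<open>s\<close> is small.\<close>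

lemma m0_le_Z: "m 0 \<le> 3 * Z" and ms_le_Z: "m s \<le> s * Z"
proof -
  obtain F where F: "\<And>x. (F has_real_derivative u x) (at x)"
    using continuous_antiderivative[OF cont_u] by blast
  have F_le: "F b - F a \<le> Z" if "a \<le> b" for a b
    unfolding Z_def using u_pos by (intro increment_le_integral[OF F cont_u _ integrable_u that]) (simp add: less_imp_le)
  have "\<bar>m 0 / 3 * 0 - m 0 / 3 * (-1)\<bar> \<le> F 0 - F (-1)"
  proof (rule increment_bound[where f = "\<lambda>_. m 0 / 3", OF _ _ F])
    show "\<bar>m 0 / 3\<bar> \<le> u x" if "-1 \<le> x" "x \<le> 0" for x
      using m_near_0[of x] m_le_u[of x] that s_pos m_pos[of 0] by simp
  qed (auto intro!: derivative_eq_intros)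
  then show "m 0 \<le> 3 * Z" using F_le[of "-1" 0] m_pos[of 0] by simp
  have "(m s - m x) / s \<le> Z" if "s \<le> x" for x
  proof -
    have "\<bar>- (m x / s) - (- (m s / s))\<bar> \<le> F x - F s"
    proof (rule increment_bound[where f = u, OF that _ F])
      fix y assume y: "s \<le> y" "y \<le> x"
      have "((\<lambda>x. - (m x / s)) has_real_derivative - ((- min y s * u y) / s)) (at y)"
        by (rule DERIV_minus, rule DERIV_cdivide, rule m_deriv)
      moreover have "min y s = s" using y by simp
      ultimately show "((\<lambda>x. - (m x / s)) has_real_derivative u y) (at y)" using s_pos by simp
    qed (use u_pos in \<open>auto simp: less_imp_le\<close>)
    moreover have "(m s - m x) / s = - (m x / s) - (- (m s / s))" by (simp add: diff_divide_distrib)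
    ultimately show ?thesis using F_le[OF that] by linarith
  qed
  then have "\<forall>\<^sub>F x in at_top. (m s - m x) / s \<le> Z"
    by (auto intro: eventually_mono[OF eventually_ge_at_top[of s]])
  moreover have "((\<lambda>x. (m s - m x) / s) \<longlongrightarrow> (m s - 0) / s) at_top"
    using s_pos by (intro tendsto_intros m_lim) auto
  ultimately have "m s / s \<le> Z" by (auto intro: tendsto_upperbound)
  then show "m s \<le> s * Z" using s_pos by (simp add: field_simps)
qed

lemma Z_pos: "0 < Z" using m0_le_Z m_pos[of 0] by simp

text \<open>Both cases give 7/2 * 3, rounded up to 11. For \<open>s \<ge> 1\<close> the constant
  \<open>c\<close> is bounded; for \<open>s < 1\<close> the point \<open>s\<close> is so close to 0
  that \<open>m 0 \<le> 3 * m s \<le> 3 * s * Z\<close>.\<close>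

lemma mean_abs_bound: "(\<integral>y. \<bar>y\<bar> * u y \<partial>lborel) \<le> 11 * (1 + 1 / s) * Z"
proof (cases "1 \<le> s")
  case True
  have "dl * s \<le> 1 * s" using dl_le_1 s_pos by (intro mult_right_mono) auto
  moreover have "s * 1 \<le> s * s" using True by (intro mult_left_mono) auto
  ultimately have "2 + dl * s \<le> 3 * s^2" using True unfolding power2_eq_square by linarith
  then have "c \<le> 3/2" using s_pos by (simp add: c_def divide_simps)
  then have "(2 + c) * m 0 \<le> 7/2 * m 0" using m_pos[of 0] by (intro mult_right_mono) auto
  then have "(\<integral>y. \<bar>y\<bar> * u y \<partial>lborel) \<le> 7/2 * m 0" using integral_abs_u by linarith
  also have "\<dots> \<le> 7/2 * (3 * Z)" using m0_le_Z by simp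
  also have "\<dots> \<le> 11 * (1 + 1 / s) * Z"
  proof -
    have "0 \<le> Z / s" using Z_pos s_pos by simp
    moreover have "11 * (1 + 1 / s) * Z = 11 * Z + 11 * (Z / s)" by (simp add: algebra_simps)
    ultimately show ?thesis using Z_pos by linarith
  qed
  finally show ?thesis .
next
  case False
  have "m 0 \<le> 3 * m s" using False s_pos by (intro m_near_0) auto
  then have "m 0 \<le> 3 * (s * Z)" using ms_le_Z by linarith
  then have "(2 + c) * m 0 \<le> (2 + c) * (3 * (s * Z))" using c_pos by (intro mult_left_mono) auto
  moreover have "(2 + c) * s \<le> 7/2 * (1 / s)"
  proof -
    have "dl * s \<le> 1" using dl_le_1 False s_pos dl_pos by (intro mult_le_one) auto
    moreover have "s * s \<le> 1" using False s_pos by (intro mult_le_one) auto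
    moreover have "(2 + c) * s = (4 * (s * s) + 2 + dl * s) / (2 * s)"
      using s_pos by (simp add: c_def power2_eq_square field_simps)
    ultimately show ?thesis using s_pos by (simp add: field_simps)
  qed
  then have "(2 + c) * s * (3 * Z) \<le> 7/2 * (1 / s) * (3 * Z)" using Z_pos by (intro mult_right_mono) auto
  ultimately have "(\<integral>y. \<bar>y\<bar> * u y \<partial>lborel) \<le> 7/2 * (1 / s) * (3 * Z)" using integral_abs_u by (simp add: mult_ac)
  also have "\<dots> \<le> 11 * (1 + 1 / s) * Z" using s_pos Z_pos by (simp add: field_simps)
  finally show ?thesis .
qed

text \<open>After multiplication by \<open>u\<close> the left side becomes
  \<open>m * g' + m' * g = (m * g)'\<close>. Hence \<open>g = M / m\<close>, where \<open>M\<close>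
  is the antiderivative of \<open>(hbar - h) * u\<close> that vanishes at both ends, and bounding
  \<open>g\<close> means bounding \<open>M\<close> by a multiple of \<open>m\<close>.\<close>

lemma stein_equation_solution:
  fixes h :: "real \<Rightarrow> real"
  assumes lip: "\<And>x y. \<bar>h x - h y\<bar> \<le> \<bar>x - y\<bar>"
  defines "hbar \<equiv> (\<integral>x. h x * u x \<partial>lborel) / Z"
  defines "K \<equiv> 400 * (1 + 1 / s)"
  obtains g g' where "\<And>x. (g has_real_derivative g' x) (at x)"
    "\<And>x. A x / 2 * g' x - min x s * g x = hbar - h x"
    "\<And>x. x \<le> s \<Longrightarrow> \<bar>g x\<bar> \<le> K"
    "\<And>x. x \<le> s \<Longrightarrow> \<bar>g' x\<bar> \<le> K * (1 + \<bar>x\<bar>)"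
    "\<And>x. s \<le> x \<Longrightarrow> \<bar>g' x\<bar> \<le> 1 / s"
proof -
  have cont_h: "continuous_on UNIV h"
    by (rule lipschitz_on_continuous_on[of 1], rule lipschitz_onI) (use lip in \<open>auto simp: dist_real_def\<close>)
  have [measurable]: "h \<in> borel_measurable borel" using cont_h by (rule borel_measurable_continuous_onI)
  have int_diff: "integrable lborel (\<lambda>x. (h x - h 0) * u x)"
  proof (rule Bochner_Integration.integrable_bound[OF integrable_abs_u])
    show "AE x in lborel. norm ((h x - h 0) * u x) \<le> norm (\<bar>x\<bar> * u x)"
    proof (intro AE_I2)
      fix x show "norm ((h x - h 0) * u x) \<le> norm (\<bar>x\<bar> * u x)"
        using mult_right_mono[OF lip[of x 0], of "\<bar>u x\<bar>"] by (simp add: abs_mult)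
    qed
  qed simp
  have int_hu: "integrable lborel (\<lambda>x. h x * u x)"
    using Bochner_Integration.integrable_add[OF int_diff integrable_mult_right[OF integrable_u, of "h 0"]]
    by (simp add: algebra_simps)
  have hZ: "hbar * Z = (\<integral>x. h x * u x \<partial>lborel)" using Z_pos by (simp add: hbar_def)
  define D where "D = 11 * (1 + 1 / s)"
  have D11: "11 \<le> D" using s_pos by (simp add: D_def)
  have D: "\<bar>hbar - h 0\<bar> \<le> D"
  proof -
    have "(hbar - h 0) * Z = (\<integral>x. (h x - h 0) * u x \<partial>lborel)"
      using int_hu integrable_u hZ by (simp add: left_diff_distrib Z_def)
    also have "\<bar>\<dots>\<bar> \<le> (\<integral>x. \<bar>(h x - h 0) * u x\<bar> \<partial>lborel)" by (rule integral_abs_bound)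
    also have "\<dots> \<le> (\<integral>x. \<bar>x\<bar> * u x \<partial>lborel)"
    proof (intro integral_mono integrable_abs int_diff integrable_abs_u)
      fix x show "\<bar>(h x - h 0) * u x\<bar> \<le> \<bar>x\<bar> * u x"
        using mult_right_mono[OF lip[of x 0], of "u x"] u_pos[of x] by (simp add: abs_mult)
    qed
    also have "\<dots> \<le> D * Z" using mean_abs_bound by (simp add: D_def)
    finally show ?thesis using Z_pos by (simp add: abs_mult)
  qed
  have hD: "\<bar>hbar - h y\<bar> \<le> D + \<bar>y\<bar>" for y using D lip[of 0 y] by simp
  define f where "f = (\<lambda>x. (hbar - h x) * u x)"
  have f_bound: "\<bar>f y\<bar> \<le> (D + \<bar>y\<bar>) * u y" for y
    using mult_right_mono[OF hD[of y], of "u y"] u_pos[of y] by (simp add: f_def abs_mult)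
  have "continuous_on UNIV f" unfolding f_def by (intro continuous_intros cont_h cont_u)
  moreover have "integrable lborel f"
    using Bochner_Integration.integrable_diff[OF integrable_mult_right[OF integrable_u, of hbar] int_hu]
    by (simp add: f_def left_diff_distrib)
  moreover have "(\<integral>x. f x \<partial>lborel) = 0"
    using int_hu integrable_u hZ by (simp add: f_def left_diff_distrib Z_def)
  ultimately obtain M where M: "\<And>x. (M has_real_derivative f x) (at x)"
    and M_bot: "(M \<longlongrightarrow> 0) at_bot" and M_top: "(M \<longlongrightarrow> 0) at_top"
    using antiderivative_vanishing_at_infinity[of f] by blast

  \<comment> \<open>For \<open>y \<le> -1\<close> the constant \<open>D\<close> is absorbed by
    \<open>D * \<bar>y\<bar>\<close>, and \<open>\<bar>y\<bar> * u y\<close> is the derivative of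
    \<open>m\<close>.\<close>
  have M_left: "\<bar>M x\<bar> \<le> (D + 1) * m x" if "x \<le> - 1" for x
  proof (rule comparison_at_bot[OF M _ _ _ M_bot])
    fix y assume y: "y \<le> x"
    show "((\<lambda>x. (D + 1) * m x) has_real_derivative (D + 1) * (- min y s * u y)) (at y)"
      by (rule DERIV_cmult[OF m_deriv])
    have "D * 1 \<le> D * (- y)" using y that D11 by (intro mult_left_mono) auto
    then have "D + \<bar>y\<bar> \<le> (D + 1) * (- y)" using y that by (simp add: distrib_right)
    then have "(D + \<bar>y\<bar>) * u y \<le> (D + 1) * (- y) * u y" using u_pos[of y] by (intro mult_right_mono) auto
    moreover have "min y s = y" using y that s_pos by simp
    ultimately show "\<bar>f y\<bar> \<le> (D + 1) * (- min y s * u y)" using f_bound[of y] by (simp add: mult.assoc)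
    show "0 \<le> (D + 1) * m y" using D11 m_pos[of y] by simp
  qed
  \<comment> \<open>Near 0 the derivative of \<open>m\<close> vanishes and cannot serve as majorant,
    so a constant slope is used: 1 + 2 * 2 = 5, times 3 from \<open>m_near_0\<close>.\<close>
  have M_mid: "\<bar>M x\<bar> \<le> 15 * (D + 1) * m x" if "-1 \<le> x" "x \<le> 1" "x \<le> s" for x
  proof -
    have "\<bar>M x - M (-1)\<bar> \<le> 2 * (D + 1) * m 0 * x - 2 * (D + 1) * m 0 * (-1)"
    proof (rule increment_bound[OF that(1) M])
      fix y assume y: "-1 \<le> y" "y \<le> x"
      show "((\<lambda>x. 2 * (D + 1) * m 0 * x) has_real_derivative 2 * (D + 1) * m 0) (at y)"
        by (auto intro!: derivative_eq_intros)
      have "(D + \<bar>y\<bar>) * u y \<le> (D + 1) * (2 * m 0)"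
        using y that u_le[of y] m_le_m0[of y] D11 u_pos[of y] by (intro mult_mono) auto
      then show "\<bar>f y\<bar> \<le> 2 * (D + 1) * m 0" using f_bound[of y] by (simp add: mult_ac)
    qed
    moreover have "2 * (D + 1) * m 0 * x \<le> 2 * (D + 1) * m 0 * 1"
      using that D11 m_pos[of 0] by (intro mult_left_mono) auto
    moreover have "\<bar>M (-1)\<bar> \<le> (D + 1) * m 0"
    proof -
      have "(D + 1) * m (-1) \<le> (D + 1) * m 0" using D11 by (intro mult_left_mono m_le_m0) auto
      then show ?thesis using M_left[of "-1"] by linarith
    qed
    ultimately have "\<bar>M x\<bar> \<le> 5 * (D + 1) * m 0" by linarith
    also have "\<dots> \<le> 5 * (D + 1) * (3 * m x)"
      using that D11 by (intro mult_left_mono m_near_0) auto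
    also have "\<dots> = 15 * (D + 1) * m x" by (simp add: algebra_simps)
    finally show ?thesis .
  qed
  \<comment> \<open>Nonvacuous only for \<open>s \<ge> 1\<close>. The estimate comes down from
    infinity to \<open>s\<close> with the tail potential, then back to \<open>x\<close> with
    \<open>- m\<close>.\<close>
  have M_right: "\<bar>M x\<bar> \<le> 15 * (D + 1) * m x" if "1 \<le> x" "x \<le> s" for x
  proof -
    have f_right: "\<bar>f y\<bar> \<le> (D + 1) * (y * u y)" if "1 \<le> y" for y
    proof -
      have "D * 1 \<le> D * y" using that D11 by (intro mult_left_mono) auto
      then have "D + \<bar>y\<bar> \<le> (D + 1) * y" using that by (simp add: distrib_right)
      then have "(D + \<bar>y\<bar>) * u y \<le> (D + 1) * y * u y" using u_pos[of y] by (intro mult_right_mono) auto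
      then show ?thesis using f_bound[of y] by (simp add: mult.assoc)
    qed
    have s1: "1 \<le> s" using that by simp
    have "\<bar>M s\<bar> \<le> (D + 1) * ((s / s + c) * m s)"
    proof (rule comparison_at_top[OF M _ _ _ M_top, where V = "\<lambda>y. (D + 1) * ((y / s + c) * m y)"])
      fix y assume y: "s \<le> y"
      show "((\<lambda>y. (D + 1) * ((y / s + c) * m y)) has_real_derivative - ((D + 1) * (y * u y))) (at y)"
        using DERIV_cmult[OF tail_potential_deriv[OF y], of "D + 1"] by simp
      show "\<bar>f y\<bar> \<le> (D + 1) * (y * u y)" using f_right y s1 by simp
      show "0 \<le> (D + 1) * ((y / s + c) * m y)" using D11 y s_pos c_pos m_pos[of y] by simp
    qed
    moreover have "(D + 1) * ((s / s + c) * m s) \<le> (D + 1) * (5/2 * m s)"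
    proof -
      have "dl * s \<le> 1 * s" using dl_le_1 s_pos by (intro mult_right_mono) auto
      moreover have "s * 1 \<le> s * s" using s1 by (intro mult_left_mono) auto
      ultimately have "2 + dl * s \<le> 3 * s^2" using s1 unfolding power2_eq_square by linarith
      then have "c \<le> 3/2" using s_pos by (simp add: c_def divide_simps)
      then show ?thesis using s_pos D11 m_pos[of s] by (intro mult_left_mono mult_right_mono) auto
    qed
    moreover have "\<bar>M s - M x\<bar> \<le> - ((D + 1) * m s) - (- ((D + 1) * m x))"
    proof (rule increment_bound[OF that(2) M])
      fix y assume y: "x \<le> y" "y \<le> s"
      show "((\<lambda>x. - ((D + 1) * m x)) has_real_derivative (D + 1) * (min y s * u y)) (at y)"
        using DERIV_minus[OF DERIV_cmult[OF m_deriv[of y], of "D + 1"]] by simp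
      show "\<bar>f y\<bar> \<le> (D + 1) * (min y s * u y)" using f_right[of y] y that by (simp add: min_def)
    qed
    moreover have "(D + 1) * m s \<le> (D + 1) * m x"
      using D11 that by (intro mult_left_mono m_antimono_right) auto
    ultimately show ?thesis using D11 m_pos[of x] by linarith
  qed
  have M_bound: "\<bar>M x\<bar> \<le> 15 * (D + 1) * m x" if "x \<le> s" for x
  proof -
    have "0 \<le> (D + 1) * m x" using D11 m_pos[of x] by simp
    then have "\<bar>M x\<bar> \<le> 15 * (D + 1) * m x" if "x \<le> -1" using M_left[OF that] by linarith
    then show ?thesis using M_mid[of x] M_right[of x] that by linarith
  qed

  define g where "g = (\<lambda>x. M x / m x)"
  define g' where "g' = (\<lambda>x. 2 / A x * (hbar - h x + min x s * g x))"
  have g_deriv: "(g has_real_derivative g' x) (at x)" for x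
  proof -
    have "(g has_real_derivative (f x * m x - M x * (- min x s * u x)) / (m x * m x)) (at x)"
      unfolding g_def using m_pos[of x] by (intro DERIV_divide M m_deriv) auto
    moreover have "(f x * m x - M x * (- min x s * u x)) / (m x * m x) = g' x"
      using m_pos[of x] A_ge_1[of x] by (simp add: f_def g'_def g_def u_def field_simps)
    ultimately show ?thesis by simp
  qed
  have g_bound: "\<bar>g x\<bar> \<le> 15 * (D + 1)" if "x \<le> s" for x
    using M_bound[OF that] m_pos[of x] by (simp add: g_def abs_divide divide_le_eq)
  \<comment> \<open>With \<open>t = 1 + 1 / s \<ge> 1\<close> the left side is 165 * t + 15. The 400
    in \<open>K\<close> is twice 200, and 200 leaves room for 180 from \<open>g\<close>, 11 from
    \<open>D\<close> and 1 from the growth of \<open>h\<close>.\<close>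
  have DK: "15 * (D + 1) \<le> 180 * (1 + 1 / s)" using s_pos by (simp add: D_def divide_right_mono)
  show thesis
  proof (rule that[OF g_deriv])
    show "A x / 2 * g' x - min x s * g x = hbar - h x" for x
      using A_ge_1[of x] by (simp add: g'_def field_simps)
    show "\<bar>g x\<bar> \<le> K" if "x \<le> s" for x
      using g_bound[OF that] DK s_pos by (simp add: K_def)
    show "\<bar>g' x\<bar> \<le> K * (1 + \<bar>x\<bar>)" if "x \<le> s" for x
    proof -
      define t where "t = 1 + 1 / s"
      have t: "1 \<le> t" using s_pos by (simp add: t_def)
      have "\<bar>hbar - h x + min x s * g x\<bar> \<le> \<bar>hbar - h x\<bar> + \<bar>x * g x\<bar>" using that by (simp add: abs_triangle_ineq)
      also have "\<dots> \<le> (D + \<bar>x\<bar>) + \<bar>x\<bar> * (180 * t)"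
        using g_bound[OF that] DK by (intro add_mono hD) (auto simp: abs_mult t_def intro!: mult_left_mono)
      also have "\<dots> \<le> 200 * t * (1 + \<bar>x\<bar>)"
      proof -
        have "\<bar>x\<bar> * 1 \<le> \<bar>x\<bar> * t" using t by (intro mult_left_mono) auto
        moreover have "D = 11 * t" by (simp add: D_def t_def)
        ultimately show ?thesis using t by (simp add: algebra_simps)
      qed
      finally have *: "\<bar>hbar - h x + min x s * g x\<bar> \<le> 200 * t * (1 + \<bar>x\<bar>)" .
      have "\<bar>g' x\<bar> = 2 / A x * \<bar>hbar - h x + min x s * g x\<bar>"
        using A_ge_1[of x] unfolding g'_def abs_mult by simp
      also have "\<dots> \<le> 2 * (200 * t * (1 + \<bar>x\<bar>))"
        using A_ge_1[of x] * t by (intro mult_mono) (auto simp: divide_simps)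
      also have "\<dots> = K * (1 + \<bar>x\<bar>)" by (simp add: K_def t_def algebra_simps)
      finally show ?thesis .
    qed
    show "\<bar>g' x\<bar> \<le> 1 / s" if "s \<le> x" for x
    proof -
      define a where "a = 2 + dl * s"
      have a: "0 < a" using s_pos dl_pos by (simp add: a_def add_pos_pos)
      \<comment> \<open>Freezing \<open>h\<close> at \<open>x\<close> leaves only increments of \<open>h\<close> in \<open>k'\<close>, so that \<open>D\<close> does not enter.\<close>
      define k where "k = (\<lambda>y. (hbar - h x) * m y + s * M y)"
      have k_deriv: "(k has_real_derivative (h x - h y) * (s * u y)) (at y)" if "s \<le> y" for y
      proof -
        have "(k has_real_derivative (hbar - h x) * (- min y s * u y) + s * f y) (at y)"
          unfolding k_def by (intro DERIV_add DERIV_cmult m_deriv M)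
        then show ?thesis using that by (simp add: f_def min_absorb2 algebra_simps)
      qed
      have k_lim: "(k \<longlongrightarrow> 0) at_top"
        unfolding k_def using tendsto_add[OF tendsto_mult_left[OF m_lim] tendsto_mult_left[OF M_top]] by simp
      \<comment> \<open>\<open>a / (2 * s)\<close> is chosen so that
        \<open>V' = - ((y - x) * s * u)\<close>, and at \<open>x\<close> the quotient
        \<open>k / m\<close> equals \<open>a / 2 * g'\<close>.\<close>
      have "\<bar>k x\<bar> \<le> ((x - x) + a / (2 * s)) * m x"
      proof (rule comparison_at_top[OF k_deriv _ _ _ k_lim, where V = "\<lambda>y. ((y - x) + a / (2 * s)) * m y"])
        fix y assume y: "x \<le> y"
        show "s \<le> y" using y that by simp
        have "((\<lambda>y. ((y - x) + a / (2 * s)) * m y) has_real_derivative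
            1 * m y + (- min y s * u y) * ((y - x) + a / (2 * s))) (at y)"
          by (rule DERIV_mult[OF _ m_deriv]) (auto intro!: derivative_eq_intros)
        moreover have "1 * m y + (- min y s * u y) * ((y - x) + a / (2 * s)) = - ((y - x) * (s * u y))"
        proof -
          have "u y * a = 2 * m y" using a y that by (simp add: u_def A_tail a_def)
          moreover have "min y s = s" using y that by simp
          ultimately show ?thesis using s_pos by (simp add: field_simps)
        qed
        ultimately show "((\<lambda>y. ((y - x) + a / (2 * s)) * m y) has_real_derivative - ((y - x) * (s * u y))) (at y)"
          by simp
        show "\<bar>(h x - h y) * (s * u y)\<bar> \<le> (y - x) * (s * u y)"
          using lip[of x y] y s_pos u_pos[of y] by (auto simp: abs_mult intro!: mult_right_mono)
        show "0 \<le> ((y - x) + a / (2 * s)) * m y" using y a s_pos m_pos[of y] by simp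
      qed
      moreover have "k x = (hbar - h x + s * g x) * m x" using m_pos[of x] by (simp add: k_def g_def field_simps)
      ultimately have "\<bar>hbar - h x + s * g x\<bar> * m x \<le> a / (2 * s) * m x" using m_pos[of x] by (simp add: abs_mult)
      then have "\<bar>hbar - h x + s * g x\<bar> \<le> a / (2 * s)" using m_pos[of x] by (rule mult_right_le_imp_le)
      moreover have "\<bar>g' x\<bar> = 2 / a * \<bar>hbar - h x + s * g x\<bar>"
        using that a unfolding g'_def abs_mult A_tail[OF that] a_def[symmetric] by simp
      ultimately have "\<bar>g' x\<bar> \<le> 2 / a * (a / (2 * s))"
        using a by (simp only: mult_left_mono divide_nonneg_pos zero_le_numeral)
      then show ?thesis using a by simp
    qed
  qed
qed

end

section \<open>Smoothing and the error on one cell\<close>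

lemma second_order_remainder:
  fixes H H' :: "real \<Rightarrow> real"
  assumes deriv: "\<And>x. (H has_real_derivative H' x) (at x)"
    and lip: "\<And>x y. \<bar>H' x - H' y\<bar> \<le> \<bar>x - y\<bar>"
  shows "\<bar>H (x + v) - H x - v * H' x\<bar> \<le> v^2"
proof -
  have "\<bar>H b - H a - (b - a) * H' x\<bar> \<le> (b - a)^2" if "a < b" "x = a \<or> x = b" for a b
  proof -
    note ab = that(1)
    obtain z where z: "a < z" "z < b" "H b - H a = (b - a) * H' z"
      using MVT2[OF ab, of H H'] deriv by blast
    then have "\<bar>H b - H a - (b - a) * H' x\<bar> = (b - a) * \<bar>H' z - H' x\<bar>"
      using that by (simp add: abs_mult flip: right_diff_distrib)
    also have "\<dots> \<le> (b - a) * (b - a)" using that z lip[of z x] by (intro mult_left_mono) auto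
    finally show ?thesis by (simp add: power2_eq_square)
  qed
  from this[of x "x + v"] this[of "x + v" x] show ?thesis
    by (cases v "0 :: real" rule: linorder_cases) (auto simp: abs_if algebra_simps split: if_splits)
qed

lemma has_integral_unit_bound:
  fixes f :: "real \<Rightarrow> real"
  assumes f: "(f has_integral i) {0..1}" and B: "\<And>\<theta>. 0 \<le> \<theta> \<Longrightarrow> \<theta> \<le> 1 \<Longrightarrow> \<bar>f \<theta>\<bar> \<le> B"
  shows "\<bar>i\<bar> \<le> B"
proof -
  have "0 \<le> B" using B[of 0] by simp
  then have "norm i \<le> B * measure lborel {0..1::real}"
    by (rule has_integral_bound_real[OF _ finite.emptyI f]) (use B in auto)
  then show ?thesis by simp
qed

lemma midpoint_square_bound:
  fixes \<theta> :: real
  assumes "0 \<le> \<theta>" "\<theta> \<le> 1"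
  shows "\<bar>1/4 - (\<theta> - 1/2)^2\<bar> \<le> 1/4"
proof -
  have "\<bar>\<theta> - 1/2\<bar> \<le> \<bar>1/2\<bar>" using assms by linarith
  then have "(\<theta> - 1/2)^2 \<le> (1/2)^2" by (simp only: abs_le_square_iff)
  moreover have "(1/2 :: real)^2 = 1/4" by (simp add: power2_eq_square)
  moreover have "0 \<le> (\<theta> - 1/2)^2" by simp
  ultimately show ?thesis unfolding abs_le_iff by linarith
qed

lemma has_integral_triangle_weights:
  fixes \<eta> d :: real
  shows "((\<lambda>\<theta>::real. (1 - \<theta>) * (\<eta> + d * \<theta>)) has_integral (\<eta> / 2 + d / 6)) {0..1}"
    and "((\<lambda>\<theta>::real. \<theta> * (\<eta> - d * (1 - \<theta>))) has_integral (\<eta> / 2 - d / 6)) {0..1}"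
proof -
  have "((\<lambda>\<theta>::real. (1 - \<theta>) * (\<eta> + d * \<theta>)) has_integral
    (\<eta> * 1 + (d - \<eta>) * 1^2 / 2 - d * 1^3 / 3) - (\<eta> * 0 + (d - \<eta>) * 0^2 / 2 - d * 0^3 / 3)) {0..1}"
    by (intro fundamental_theorem_of_calculus)
       (auto intro!: derivative_eq_intros simp: power2_eq_square field_simps
         simp flip: has_real_derivative_iff_has_vector_derivative)
  then show "((\<lambda>\<theta>::real. (1 - \<theta>) * (\<eta> + d * \<theta>)) has_integral (\<eta> / 2 + d / 6)) {0..1}"
    by (simp add: field_simps)
  have "((\<lambda>\<theta>::real. \<theta> * (\<eta> - d * (1 - \<theta>))) has_integral
    ((\<eta> - d) * 1^2 / 2 + d * 1^3 / 3) - ((\<eta> - d) * 0^2 / 2 + d * 0^3 / 3)) {0..1}"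
    by (intro fundamental_theorem_of_calculus)
       (auto intro!: derivative_eq_intros simp: power2_eq_square field_simps
         simp flip: has_real_derivative_iff_has_vector_derivative)
  then show "((\<lambda>\<theta>::real. \<theta> * (\<eta> - d * (1 - \<theta>))) has_integral (\<eta> / 2 - d / 6)) {0..1}"
    by (simp add: field_simps)
qed

text \<open>The first-order terms of the two halves, \<open>e * H' x / 6\<close> and its negative,
  cancel by the symmetry of the kernel; each half leaves a remainder of at most \<open>e^2\<close>.
  This is where the Lipschitz bound on the derivative of the test function enters.\<close>

lemma triangle_smoothing_error:
  fixes H H' :: "real \<Rightarrow> real"
  assumes deriv: "\<And>x. (H has_real_derivative H' x) (at x)"
    and lip: "\<And>x y. \<bar>H' x - H' y\<bar> \<le> \<bar>x - y\<bar>"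
  shows "\<bar>integral {0..1} (\<lambda>\<theta>. (1 - \<theta>) * H (x + e * \<theta>))
     + integral {0..1} (\<lambda>\<theta>. \<theta> * H (x - e + e * \<theta>)) - H x\<bar> \<le> 2 * e^2"
proof -
  have cont: "continuous_on S H" for S
    using deriv by (meson DERIV_isCont continuous_at_imp_continuous_on)
  have *: "\<bar>\<theta> * r\<bar> \<le> e^2" if "0 \<le> \<theta>" "\<theta> \<le> 1" "\<bar>r\<bar> \<le> (e * q)^2" "0 \<le> q" "q \<le> 1" for \<theta> r q :: real
  proof -
    have "(e * q)^2 = e^2 * q^2" by (simp add: power_mult_distrib)
    also have "\<dots> \<le> e^2 * 1" using that by (intro mult_left_mono power_le_one) auto
    finally have "\<bar>r\<bar> \<le> e^2" using that by simp
    then have "\<bar>\<theta>\<bar> * \<bar>r\<bar> \<le> 1 * e^2" using that by (intro mult_mono) auto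
    then show ?thesis by (simp add: abs_mult)
  qed
  have "((\<lambda>\<theta>. (1 - \<theta>) * H (x + e * \<theta>)) has_integral integral {0..1} (\<lambda>\<theta>. (1 - \<theta>) * H (x + e * \<theta>))) {0..1}"
    by (intro integrable_integral integrable_continuous_interval continuous_intros
      continuous_on_compose2[OF cont[of UNIV]]) auto
  from has_integral_diff[OF this has_integral_triangle_weights(1)[of "H x" "e * H' x"]]
  have "\<bar>integral {0..1} (\<lambda>\<theta>. (1 - \<theta>) * H (x + e * \<theta>)) - (H x / 2 + e * H' x / 6)\<bar> \<le> e^2"
  proof (rule has_integral_unit_bound)
    fix \<theta> :: real assume \<theta>: "0 \<le> \<theta>" "\<theta> \<le> 1"
    show "\<bar>(1 - \<theta>) * H (x + e * \<theta>) - (1 - \<theta>) * (H x + e * H' x * \<theta>)\<bar> \<le> e^2"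
      using \<theta> *[of "1 - \<theta>" "H (x + e * \<theta>) - H x - e * \<theta> * H' x" \<theta>]
        second_order_remainder[OF deriv lip, of x "e * \<theta>"] by (simp add: algebra_simps)
  qed
  moreover have "((\<lambda>\<theta>. \<theta> * H (x - e + e * \<theta>)) has_integral integral {0..1} (\<lambda>\<theta>. \<theta> * H (x - e + e * \<theta>))) {0..1}"
    by (intro integrable_integral integrable_continuous_interval continuous_intros
      continuous_on_compose2[OF cont[of UNIV]]) auto
  from has_integral_diff[OF this has_integral_triangle_weights(2)[of "H x" "e * H' x"]]
  have "\<bar>integral {0..1} (\<lambda>\<theta>. \<theta> * H (x - e + e * \<theta>)) - (H x / 2 - e * H' x / 6)\<bar> \<le> e^2"
  proof (rule has_integral_unit_bound)
    fix \<theta> :: real assume \<theta>: "0 \<le> \<theta>" "\<theta> \<le> 1"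
    have "\<bar>H (x + (- e * (1 - \<theta>))) - H x - (- e * (1 - \<theta>)) * H' x\<bar> \<le> (- e * (1 - \<theta>))^2"
      by (rule second_order_remainder[OF deriv lip])
    then show "\<bar>\<theta> * H (x - e + e * \<theta>) - \<theta> * (H x - e * H' x * (1 - \<theta>))\<bar> \<le> e^2"
    proof -
      have "(- e * (1 - \<theta>))^2 = (e * (1 - \<theta>))^2" by (simp add: power2_eq_square)
      moreover have "\<theta> * H (x - e + e * \<theta>) - \<theta> * (H x - e * H' x * (1 - \<theta>))
          = \<theta> * (H (x + (- e * (1 - \<theta>))) - H x - (- e * (1 - \<theta>)) * H' x)"
        by (simp add: algebra_simps)
      moreover note \<open>\<bar>H (x + (- e * (1 - \<theta>))) - H x - (- e * (1 - \<theta>)) * H' x\<bar> \<le> (- e * (1 - \<theta>))^2\<close>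
      ultimately show ?thesis using \<theta> by (simp only:) (rule *[where q = "1 - \<theta>"], auto)
    qed
  qed
  ultimately show ?thesis by simp
qed

text \<open>\<open>\<beta> \<rho> - (\<alpha> \<rho>)'\<close> measures how far \<open>\<rho>\<close> is from being stationary for the diffusion. Its part that
  is odd about the midpoint of the cell is integrated by parts a second time, which gains a
  factor \<open>dl\<close>.\<close>
lemma cell_error:
  fixes g g' H \<alpha> \<beta> \<rho> \<gamma> res :: "real \<Rightarrow> real"
  assumes dl: "0 < dl"
    and g: "\<And>y. (g has_real_derivative g' y) (at y)"
    and H: "\<And>\<theta>. 0 \<le> \<theta> \<Longrightarrow> \<theta> \<le> 1 \<Longrightarrow>
      H (x + dl * \<theta>) = - dl * (\<alpha> \<theta> * (dl * g' (x + dl * \<theta>)) + \<beta> \<theta> * g (x + dl * \<theta>))"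
    and contH: "continuous_on UNIV H" and cont_\<rho>: "continuous_on {0..1} \<rho>"
    and flux: "\<And>\<theta>. ((\<lambda>\<theta>. \<alpha> \<theta> * \<rho> \<theta>) has_real_derivative \<gamma> \<theta>) (at \<theta>)"
    and e: "\<And>\<theta>. \<beta> \<theta> * \<rho> \<theta> - \<gamma> \<theta> = res \<theta> + \<kappa> * (\<theta> - 1/2)"
    and e1: "\<And>\<theta>. 0 \<le> \<theta> \<Longrightarrow> \<theta> \<le> 1 \<Longrightarrow> \<bar>res \<theta> * g (x + dl * \<theta>)\<bar> \<le> \<epsilon>"
    and K1: "\<And>\<theta>. 0 \<le> \<theta> \<Longrightarrow> \<theta> \<le> 1 \<Longrightarrow> \<bar>g' (x + dl * \<theta>)\<bar> \<le> K1"
  shows "\<bar>integral {0..1} (\<lambda>\<theta>. \<rho> \<theta> * H (x + dl * \<theta>))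
      + dl * (\<alpha> 1 * \<rho> 1 * g (x + dl) - \<alpha> 0 * \<rho> 0 * g x)\<bar> \<le> dl * (\<epsilon> + \<bar>\<kappa>\<bar> * dl * K1 / 8)"
proof -
  define G where "G = (\<lambda>\<theta>. g (x + dl * \<theta>))"
  define G' where "G' = (\<lambda>\<theta>. dl * g' (x + dl * \<theta>))"
  have G: "(G has_real_derivative G' \<theta>) (at \<theta>)" for \<theta>
  proof -
    have "((\<lambda>\<theta>. x + dl * \<theta>) has_real_derivative dl) (at \<theta>)" by (auto intro!: derivative_eq_intros)
    from DERIV_chain2[OF g this] show ?thesis by (simp add: G_def G'_def mult.commute)
  qed
  \<comment> \<open>The quadratic factor is an antiderivative of \<kappa> * (\<theta> - 1/2) that
    vanishes at both ends of the cell, so it adds no boundary term. Half of 1/4 bounds it, whence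
    the 1/8.\<close>
  define \<Psi> where "\<Psi> = (\<lambda>\<theta>. (\<alpha> \<theta> * \<rho> \<theta>) * G \<theta> + \<kappa> / 2 * ((\<theta> - 1/2)^2 - 1/4) * G \<theta>)"
  define \<Psi>' where "\<Psi>' = (\<lambda>\<theta>. \<gamma> \<theta> * G \<theta> + G' \<theta> * (\<alpha> \<theta> * \<rho> \<theta>)
      + (\<kappa> * (\<theta> - 1/2) * G \<theta> + G' \<theta> * (\<kappa> / 2 * ((\<theta> - 1/2)^2 - 1/4))))"
  have \<Psi>: "(\<Psi> has_real_derivative \<Psi>' \<theta>) (at \<theta>)" for \<theta>
    unfolding \<Psi>_def \<Psi>'_def
    by (intro DERIV_add DERIV_mult flux G) (auto intro!: derivative_eq_intros)
  have "(\<Psi>' has_integral \<Psi> 1 - \<Psi> 0) {0..1}"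
    using \<Psi> by (intro fundamental_theorem_of_calculus)
      (auto simp flip: has_real_derivative_iff_has_vector_derivative intro: has_field_derivative_at_within)
  then have int1: "((\<lambda>\<theta>. dl * \<Psi>' \<theta>) has_integral dl * (\<Psi> 1 - \<Psi> 0)) {0..1}"
    by (rule has_integral_mult_right)
  have int2: "((\<lambda>\<theta>. \<rho> \<theta> * H (x + dl * \<theta>)) has_integral integral {0..1} (\<lambda>\<theta>. \<rho> \<theta> * H (x + dl * \<theta>))) {0..1}"
    by (intro integrable_integral integrable_continuous_interval continuous_intros
      continuous_on_compose2[OF contH] cont_\<rho>) auto
  have "\<bar>integral {0..1} (\<lambda>\<theta>. \<rho> \<theta> * H (x + dl * \<theta>)) + dl * (\<Psi> 1 - \<Psi> 0)\<bar>
      \<le> dl * (\<epsilon> + \<bar>\<kappa>\<bar> * dl * K1 / 8)"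
  proof (rule has_integral_unit_bound[OF has_integral_add[OF int2 int1]])
    fix \<theta> :: real assume \<theta>: "0 \<le> \<theta>" "\<theta> \<le> 1"
    have "\<rho> \<theta> * H (x + dl * \<theta>) = - dl * (G' \<theta> * (\<alpha> \<theta> * \<rho> \<theta>) + (\<gamma> \<theta> + res \<theta> + \<kappa> * (\<theta> - 1/2)) * G \<theta>)"
    proof -
      have "\<gamma> \<theta> + res \<theta> + \<kappa> * (\<theta> - 1/2) = \<beta> \<theta> * \<rho> \<theta>" using e[of \<theta>] by simp
      then show ?thesis by (simp only: H[OF \<theta>] G_def G'_def) (simp add: algebra_simps)
    qed
    then have eq: "\<rho> \<theta> * H (x + dl * \<theta>) + dl * \<Psi>' \<theta>
        = dl * (- (res \<theta> * G \<theta>) + \<kappa> * dl * (((\<theta> - 1/2)^2 - 1/4) / 2 * g' (x + dl * \<theta>)))"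
      by (simp add: \<Psi>'_def G'_def algebra_simps)
    have "\<bar>((\<theta> - 1/2)^2 - 1/4) / 2 * g' (x + dl * \<theta>)\<bar> \<le> 1/8 * K1"
      unfolding abs_mult
    proof (intro mult_mono K1 \<theta>)
      show "\<bar>((\<theta> - 1/2)^2 - 1/4) / 2\<bar> \<le> 1/8"
        using midpoint_square_bound[OF \<theta>] by (simp add: abs_divide abs_minus_commute)
    qed auto
    then have "\<bar>\<kappa> * dl\<bar> * \<bar>((\<theta> - 1/2)^2 - 1/4) / 2 * g' (x + dl * \<theta>)\<bar> \<le> \<bar>\<kappa> * dl\<bar> * (1/8 * K1)"
      by (rule mult_left_mono) simp
    then have "\<bar>\<kappa> * dl * (((\<theta> - 1/2)^2 - 1/4) / 2 * g' (x + dl * \<theta>))\<bar> \<le> \<bar>\<kappa>\<bar> * dl * K1 / 8"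
      using dl by (simp add: abs_mult[of "\<kappa> * dl"] abs_mult[of \<kappa> dl])
    moreover have "\<bar>res \<theta> * G \<theta>\<bar> \<le> \<epsilon>" using e1[OF \<theta>] by (simp add: G_def)
    ultimately have "\<bar>- (res \<theta> * G \<theta>) + \<kappa> * dl * (((\<theta> - 1/2)^2 - 1/4) / 2 * g' (x + dl * \<theta>))\<bar>
        \<le> \<epsilon> + \<bar>\<kappa>\<bar> * dl * K1 / 8" by linarith
    then have "dl * \<bar>- (res \<theta> * G \<theta>) + \<kappa> * dl * (((\<theta> - 1/2)^2 - 1/4) / 2 * g' (x + dl * \<theta>))\<bar>
        \<le> dl * (\<epsilon> + \<bar>\<kappa>\<bar> * dl * K1 / 8)" using dl by (intro mult_left_mono) auto
    then show "\<bar>\<rho> \<theta> * H (x + dl * \<theta>) + dl * \<Psi>' \<theta>\<bar> \<le> dl * (\<epsilon> + \<bar>\<kappa>\<bar> * dl * K1 / 8)"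
      unfolding eq abs_mult[of dl] using dl by simp
  qed
  moreover have "\<Psi> 1 - \<Psi> 0 = \<alpha> 1 * \<rho> 1 * g (x + dl) - \<alpha> 0 * \<rho> 0 * g x"
    by (simp add: \<Psi>_def G_def power2_eq_square)
  ultimately show ?thesis by simp
qed

context erlangC_law
begin

section \<open>The coefficients on lattice cells\<close>

lemma grid_Suc: "grid (Suc k) = grid k + dl" by (simp add: grid_def algebra_simps)

lemma grid_between: "grid k + dl * \<theta> = (real k + \<theta> - R) * dl" by (simp add: grid_def algebra_simps)

text \<open>In lattice units the drift is birth rate minus death rate and the variance coefficient
  is half their sum, with the death rate \<open>k\<close> interpolated to
  \<open>k + \<theta>\<close>. These are the \<beta> and \<alpha> of
  \<open>cell_error\<close>.\<close>

lemma var_coeff_cell: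
  assumes "k < n" "0 \<le> \<theta>" "\<theta> \<le> 1"
  shows "min (grid k + dl * \<theta>) s = - dl * (R - real k - \<theta>)"
    and "var_coeff s dl (grid k + dl * \<theta>) = 2 * (dl * dl * ((R + real k + \<theta>) / 2))"
proof -
  have "real k + \<theta> \<le> real n" using assms by linarith
  then have "grid k + dl * \<theta> \<le> s"
    unfolding grid_between s_def using dl_pos by (intro mult_right_mono) auto
  then show 1: "min (grid k + dl * \<theta>) s = - dl * (R - real k - \<theta>)"
    unfolding grid_between by (simp add: algebra_simps)
  have "1 + dl * min (grid k + dl * \<theta>) s = dl * dl * (real k + \<theta>)"
    unfolding 1 using dl2 by (simp add: algebra_simps)
  then show "var_coeff s dl (grid k + dl * \<theta>) = 2 * (dl * dl * ((R + real k + \<theta>) / 2))"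
    unfolding var_coeff_def using dl2 assms by (simp add: algebra_simps)
qed

lemma var_coeff_tail_cell:
  assumes "n \<le> k" "0 \<le> \<theta>"
  shows "min (grid k + dl * \<theta>) s = - dl * (R - real n)"
    and "var_coeff s dl (grid k + dl * \<theta>) = 2 * (dl * dl * ((R + real n) / 2))"
    and "s \<le> grid k + dl * \<theta>"
proof -
  have "real n \<le> real k + \<theta>" using assms by linarith
  then show 0: "s \<le> grid k + dl * \<theta>"
    unfolding grid_between s_def using dl_pos by (intro mult_right_mono) auto
  then show 1: "min (grid k + dl * \<theta>) s = - dl * (R - real n)"
    by (simp add: s_def algebra_simps)
  have "1 + dl * min (grid k + dl * \<theta>) s = dl * dl * real n"
    unfolding 1 using dl2 by (simp add: algebra_simps)
  then show "var_coeff s dl (grid k + dl * \<theta>) = 2 * (dl * dl * ((R + real n) / 2))"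
    unfolding var_coeff_def using dl2 by (simp add: algebra_simps)
qed

text \<open>Below state 0 the maximum in \<open>var_coeff\<close> is 0, so only the birth rate
  contributes to the variance, while the drift continues linearly.\<close>

lemma var_coeff_first_cell:
  assumes "\<theta> \<le> 1"
  shows "min (grid 0 - dl + dl * \<theta>) s = - dl * (R + 1 - \<theta>)"
    and "var_coeff s dl (grid 0 - dl + dl * \<theta>) = 2 * (dl * dl * (R / 2))"
    and "grid 0 - dl + dl * \<theta> \<le> s"
proof -
  have eq: "grid 0 - dl + dl * \<theta> = - dl * (R + 1 - \<theta>)" by (simp add: grid_def algebra_simps)
  have "0 \<le> dl * (R + 1 - \<theta>)" using dl_pos R1 assms by simp
  then show 0: "grid 0 - dl + dl * \<theta> \<le> s" unfolding eq using s_pos by simp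
  then show 1: "min (grid 0 - dl + dl * \<theta>) s = - dl * (R + 1 - \<theta>)" unfolding eq by simp
  have "1 + dl * min (grid 0 - dl + dl * \<theta>) s = - (dl * dl * (1 - \<theta>))"
    unfolding 1 using dl2 by (simp add: algebra_simps)
  moreover have "0 \<le> dl * dl * (1 - \<theta>)" using assms by simp
  ultimately show "var_coeff s dl (grid 0 - dl + dl * \<theta>) = 2 * (dl * dl * (R / 2))"
    unfolding var_coeff_def using dl2 by simp
qed

lemma grid_dl: "(R - real k) / R = - grid k * dl" and grid_square: "(R - real k)^2 / R = (grid k)^2"
proof -
  have R: "1 / R = dl * dl" using dl2 R1 by (simp add: field_simps)
  have "(R - real k) / R = (R - real k) * (1 / R)" by simp
  then show "(R - real k) / R = - grid k * dl" unfolding R by (simp add: grid_def algebra_simps)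
  have "(R - real k)^2 / R = (R - real k)^2 * (1 / R)" by simp
  then show "(R - real k)^2 / R = (grid k)^2" unfolding R by (simp add: grid_def power2_eq_square algebra_simps)
qed

lemma linear_growth_vanishes:
  assumes "\<And>k. \<bar>f k\<bar> \<le> a + b * real k"
  shows "(\<lambda>k. pmf p k * f k) \<longlonglongrightarrow> 0"
  by (rule summable_LIMSEQ_zero, rule sums_summable, rule nat_pmf_expectation_sums,
      rule integrable_affine_bounded[OF assms])

lemma stein_error:
  fixes g g' H H' :: "real \<Rightarrow> real"
  assumes g: "\<And>x. (g has_real_derivative g' x) (at x)"
    and ode: "\<And>x. var_coeff s dl x / 2 * g' x - min x s * g x = - H x"
    and gK: "\<And>x. x \<le> s \<Longrightarrow> \<bar>g x\<bar> \<le> K"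
    and g'K: "\<And>x. x \<le> s \<Longrightarrow> \<bar>g' x\<bar> \<le> K * (1 + \<bar>x\<bar>)"
    and g'_tail: "\<And>x. s \<le> x \<Longrightarrow> \<bar>g' x\<bar> \<le> 1 / s"
    and H: "\<And>x. (H has_real_derivative H' x) (at x)"
    and H_lip: "\<And>x y. \<bar>H x - H y\<bar> \<le> \<bar>x - y\<bar>"
    and H'_lip: "\<And>x y. \<bar>H' x - H' y\<bar> \<le> \<bar>x - y\<bar>"
  shows "\<bar>E (\<lambda>k. H (grid k))\<bar> \<le> (K * (36 * min 1 s) + 3) * dl^2"
proof -
  have contH: "continuous_on UNIV H"
    using H by (meson DERIV_isCont continuous_at_imp_continuous_on)
  have K0: "0 \<le> K" using gK[of 0] s_pos by simp
  have H_form: "H y = - dl * (\<alpha> * (dl * g' y) + \<beta> * g y)"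
    if "var_coeff s dl y = 2 * (dl * dl * \<alpha>)" "min y s = - dl * \<beta>" for y \<alpha> \<beta>
    using ode[of y] unfolding that by (simp add: algebra_simps)
  \<comment> \<open>\<open>err j\<close> is the error of the cell ending at \<open>grid j\<close>,
    in units of \<open>dl^2\<close>; \<open>bd k\<close> is the boundary term at
    \<open>grid k\<close>. The latter is the same seen from either side, by continuity of
    \<open>var_coeff\<close>, so boundary terms telescope.\<close>
  define err where "err = (\<lambda>j. if j \<le> n then K * (pmf p j * (1 + \<bar>grid j\<bar>^3)) else s * pmf p j)"
  define bd where "bd = (\<lambda>k. (R + real (min k n)) / 2 * pmf p k * g (grid k))"
  define J where "J = (\<lambda>k. integral {0..1} (\<lambda>\<theta>. ((1 - \<theta>) * pmf p k + \<theta> * pmf p (Suc k)) * H (grid k + dl * \<theta>)))"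
  define J0 where "J0 = integral {0..1} (\<lambda>\<theta>. (\<theta> * pmf p 0) * H (grid 0 - dl + dl * \<theta>))"

  have left_cell: "dl * (\<pi> * \<bar>y\<bar> * dl / 4 * K + \<bar>\<kappa>\<bar> * dl * (K * (2 + \<bar>y\<bar>)) / 8) \<le> dl^2 * (K * (\<pi> * (1 + \<bar>y\<bar>^3)))"
    if "\<bar>\<kappa>\<bar> \<le> \<pi> * (y^2 + 1)" "0 \<le> \<pi>" for \<pi> y \<kappa> :: real
  proof -
    define t where "t = \<bar>y\<bar>"
    have t: "0 \<le> t" "y^2 = t^2" by (auto simp: t_def)
    have t1: "t \<le> 1 + t^3"
    proof (cases "t \<le> 1")
      case False
      then have "t^1 \<le> t^3" by (intro power_increasing) auto
      then show ?thesis by simp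
    qed (use t in \<open>simp add: add_increasing2\<close>)
    have t2: "t^2 \<le> 1 + t^3"
    proof (cases "t \<le> 1")
      case True
      then have "t^2 \<le> 1" using t by (simp add: power_le_one)
      then show ?thesis using t by (simp add: add_increasing2)
    next
      case False
      then have "t^2 \<le> t^3" by (intro power_increasing) auto
      then show ?thesis by simp
    qed
    have "\<pi> * t * dl / 4 * K + \<bar>\<kappa>\<bar> * dl * (K * (2 + t)) / 8
        \<le> \<pi> * t * dl / 4 * K + (\<pi> * (t^2 + 1)) * dl * (K * (2 + t)) / 8"
      using that K0 dl_pos t
      by (intro add_left_mono divide_right_mono mult_right_mono) (auto simp: mult_nonneg_nonneg)
    also have "\<dots> = dl * K * \<pi> * (1/4 + 3/8 * t + t^2 / 4 + t^3 / 8)"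
      by (simp add: field_simps power2_eq_square power3_eq_cube)
    also have "\<dots> \<le> dl * K * \<pi> * (1 + t^3)"
    proof (intro mult_left_mono)
      have "0 \<le> t^3" using t by simp
      then show "1/4 + 3/8 * t + t^2 / 4 + t^3 / 8 \<le> 1 + t^3" using t1 t2 by linarith
    qed (use dl_pos K0 that in auto)
    finally have "dl * (\<pi> * t * dl / 4 * K + \<bar>\<kappa>\<bar> * dl * (K * (2 + t)) / 8) \<le> dl * (dl * K * \<pi> * (1 + t^3))"
      using dl_pos by (intro mult_left_mono) auto
    then show ?thesis by (simp add: t_def power2_eq_square mult_ac)
  qed

  have cell0: "\<bar>J0 + dl * bd 0\<bar> \<le> dl^2 * err 0"
  proof -
    define \<pi> where "\<pi> = pmf p 0"
    define y where "y = grid 0"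
    have y2: "y^2 = R" using grid_square[of 0] R1 by (simp add: y_def power2_eq_square)
    \<comment> \<open>At the left end \<open>\<bar>y\<bar> * dl = 1\<close>, so the residual \<pi> /
      4 already has the form \<pi> * \<bar>y\<bar> * dl / 4 that \<open>left_cell\<close>
      expects.\<close>
    have ydl: "\<bar>y\<bar> * dl = 1"
      using dl2 R1 dl_pos by (simp add: y_def grid_def abs_mult mult_ac)
    have "\<bar>J0 + dl * (R / 2 * (1 * \<pi>) * g (grid 0 - dl + dl) - R / 2 * (0 * \<pi>) * g (grid 0 - dl))\<bar>
        \<le> dl * (\<pi> * \<bar>y\<bar> * dl / 4 * K + \<bar>\<pi> * R\<bar> * dl * (K * (2 + \<bar>y\<bar>)) / 8)"
      unfolding J0_def \<pi>_def[symmetric]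
    proof (rule cell_error[where \<rho> = "\<lambda>\<theta>. \<theta> * \<pi>" and \<alpha> = "\<lambda>\<theta>. R / 2" and \<beta> = "\<lambda>\<theta>. R + 1 - \<theta>"
          and \<gamma> = "\<lambda>\<theta>. R / 2 * \<pi>" and res = "\<lambda>\<theta>. \<pi> * (1/4 - (\<theta> - 1/2)^2)", OF dl_pos g _ contH])
      fix \<theta> :: real
      show "((\<lambda>\<theta>. R / 2 * (\<theta> * \<pi>)) has_real_derivative R / 2 * \<pi>) (at \<theta>)"
        by (auto intro!: derivative_eq_intros)
      show "(R + 1 - \<theta>) * (\<theta> * \<pi>) - R / 2 * \<pi> = \<pi> * (1/4 - (\<theta> - 1/2)^2) + \<pi> * R * (\<theta> - 1/2)"
        by (simp add: power2_eq_square algebra_simps)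
      assume \<theta>: "0 \<le> \<theta>" "\<theta> \<le> 1"
      let ?z = "grid 0 - dl + dl * \<theta>"
      show "H ?z = - dl * (R / 2 * (dl * g' ?z) + (R + 1 - \<theta>) * g ?z)"
        using var_coeff_first_cell[OF \<theta>(2)] by (intro H_form)
      have z: "?z \<le> s" using var_coeff_first_cell[OF \<theta>(2)] by simp
      have "\<bar>\<pi> * (1/4 - (\<theta> - 1/2)^2)\<bar> \<le> \<pi> / 4"
      proof -
        from midpoint_square_bound[OF \<theta>] have "\<pi> * \<bar>1/4 - (\<theta> - 1/2)^2\<bar> \<le> \<pi> * (1/4)" by (intro mult_left_mono) (auto simp: \<pi>_def)
        then show ?thesis by (simp add: abs_mult \<pi>_def)
      qed
      then have "\<bar>\<pi> * (1/4 - (\<theta> - 1/2)^2)\<bar> * \<bar>g ?z\<bar> \<le> \<pi> / 4 * K"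
        using gK[OF z] by (intro mult_mono) (auto simp: \<pi>_def)
      then show "\<bar>\<pi> * (1/4 - (\<theta> - 1/2)^2) * g ?z\<bar> \<le> \<pi> * \<bar>y\<bar> * dl / 4 * K"
        unfolding abs_mult[of _ "g ?z"] using ydl by (simp add: mult.assoc)
      have "\<bar>?z\<bar> \<le> \<bar>y\<bar> + dl"
      proof -
        have "0 \<le> dl * \<theta>" "dl * \<theta> \<le> dl * 1" using dl_pos \<theta> by (auto intro: mult_left_mono)
        then show "\<bar>?z\<bar> \<le> \<bar>y\<bar> + dl" unfolding y_def by linarith
      qed
      then have "1 + \<bar>?z\<bar> \<le> 2 + \<bar>y\<bar>" using dl_le_1 by linarith
      then have "K * (1 + \<bar>?z\<bar>) \<le> K * (2 + \<bar>y\<bar>)" using K0 by (rule mult_left_mono)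
      then show "\<bar>g' ?z\<bar> \<le> K * (2 + \<bar>y\<bar>)" using g'K[OF z] by linarith
    qed (auto intro!: continuous_intros)
    also have "\<dots> \<le> dl^2 * (K * (\<pi> * (1 + \<bar>y\<bar>^3)))"
      by (rule left_cell) (use R1 y2 in \<open>auto simp: \<pi>_def abs_mult algebra_simps\<close>)
    finally show ?thesis by (simp add: bd_def err_def \<pi>_def y_def mult.commute)
  qed

  have cell: "\<bar>J k + dl * (bd (Suc k) - bd k)\<bar> \<le> dl^2 * err (Suc k)" for k
  proof (cases "k < n")
    case True
    define \<pi> where "\<pi> = pmf p (Suc k)"
    define y where "y = grid (Suc k)"
    have pk: "pmf p k = real (Suc k) * \<pi> / R"
      using balance[of k] True R1 by (simp add: \<pi>_def field_simps)
    let ?\<rho> = "\<lambda>\<theta>. (1 - \<theta>) * pmf p k + \<theta> * \<pi>"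
    let ?e1 = "\<lambda>\<theta>. \<pi> * ((R - real (Suc k)) / R) * (1/4 - (\<theta> - 1/2)^2)"
    have "\<bar>J k + dl * ((R + real k + 1) / 2 * ?\<rho> 1 * g (grid k + dl) - (R + real k + 0) / 2 * ?\<rho> 0 * g (grid k))\<bar>
        \<le> dl * (\<pi> * \<bar>y\<bar> * dl / 4 * K + \<bar>\<pi> * ((R - real (Suc k))^2 / R - 1)\<bar> * dl * (K * (2 + \<bar>y\<bar>)) / 8)"
      unfolding J_def \<pi>_def[symmetric]
    proof (rule cell_error[where \<rho> = ?\<rho> and \<alpha> = "\<lambda>\<theta>. (R + real k + \<theta>) / 2" and \<beta> = "\<lambda>\<theta>. R - real k - \<theta>"
          and \<gamma> = "\<lambda>\<theta>. 1/2 * ?\<rho> \<theta> + (\<pi> - pmf p k) * ((R + real k + \<theta>) / 2)" and res = ?e1, OF dl_pos g _ contH])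
      fix \<theta> :: real
      show "((\<lambda>\<theta>. (R + real k + \<theta>) / 2 * ?\<rho> \<theta>) has_real_derivative
          1/2 * ?\<rho> \<theta> + (\<pi> - pmf p k) * ((R + real k + \<theta>) / 2)) (at \<theta>)"
        by (rule DERIV_mult) (auto intro!: derivative_eq_intros)
      \<comment> \<open>Detailed balance enters through \<open>pk\<close>: it splits the defect into
        an even part with factor \<open>(R - k - 1) / R = - y * dl\<close> and an odd part with
        factor \<open>y^2 - 1\<close>.\<close>
      show "(R - real k - \<theta>) * ?\<rho> \<theta> - (1/2 * ?\<rho> \<theta> + (\<pi> - pmf p k) * ((R + real k + \<theta>) / 2))
         = ?e1 \<theta> + \<pi> * ((R - real (Suc k))^2 / R - 1) * (\<theta> - 1/2)"
        unfolding pk using R1 by (simp add: power2_eq_square field_simps)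
      assume \<theta>: "0 \<le> \<theta>" "\<theta> \<le> 1"
      let ?z = "grid k + dl * \<theta>"
      show "H ?z = - dl * ((R + real k + \<theta>) / 2 * (dl * g' ?z) + (R - real k - \<theta>) * g ?z)"
        using var_coeff_cell[OF True \<theta>] by (intro H_form)
      have z: "?z \<le> s"
      proof -
        have "real k + \<theta> \<le> real n" using \<theta> True by linarith
        then show ?thesis unfolding grid_between s_def using dl_pos by (intro mult_right_mono) auto
      qed
      have "\<bar>?e1 \<theta>\<bar> \<le> \<pi> * \<bar>y\<bar> * dl / 4"
      proof -
        from midpoint_square_bound[OF \<theta>] have "\<bar>\<pi> * (- y * dl)\<bar> * \<bar>1/4 - (\<theta> - 1/2)^2\<bar> \<le> \<bar>\<pi> * (- y * dl)\<bar> * (1/4)"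
          by (intro mult_left_mono) auto
        moreover have "\<bar>\<pi> * (- y * dl)\<bar> = \<pi> * \<bar>y\<bar> * dl" using dl_pos by (simp add: abs_mult \<pi>_def)
        ultimately show ?thesis unfolding grid_dl y_def[symmetric] by (simp only: abs_mult[of "_ * (- y * dl)"])
      qed
      then have "\<bar>?e1 \<theta>\<bar> * \<bar>g ?z\<bar> \<le> \<pi> * \<bar>y\<bar> * dl / 4 * K"
        using gK[OF z] dl_pos by (intro mult_mono) (auto simp: \<pi>_def)
      then show "\<bar>?e1 \<theta> * g ?z\<bar> \<le> \<pi> * \<bar>y\<bar> * dl / 4 * K" by (simp only: abs_mult[of _ "g ?z"])
      have "\<bar>?z\<bar> \<le> \<bar>y\<bar> + dl"
      proof -
        have "0 \<le> dl * \<theta>" "dl * \<theta> \<le> dl * 1" using dl_pos \<theta> by (auto intro: mult_left_mono)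
        then show "\<bar>?z\<bar> \<le> \<bar>y\<bar> + dl" unfolding y_def grid_Suc by linarith
      qed
      then have "1 + \<bar>?z\<bar> \<le> 2 + \<bar>y\<bar>" using dl_le_1 by linarith
      then have "K * (1 + \<bar>?z\<bar>) \<le> K * (2 + \<bar>y\<bar>)" using K0 by (rule mult_left_mono)
      then show "\<bar>g' ?z\<bar> \<le> K * (2 + \<bar>y\<bar>)" using g'K[OF z] by linarith
    qed (auto intro!: continuous_intros)
    also have "\<dots> \<le> dl^2 * (K * (\<pi> * (1 + \<bar>y\<bar>^3)))"
    proof (rule left_cell)
      have "\<bar>y^2 - 1\<bar> \<le> y^2 + 1" using zero_le_power2[of y] by linarith
      then have "\<pi> * \<bar>y^2 - 1\<bar> \<le> \<pi> * (y^2 + 1)" by (intro mult_left_mono) (auto simp: \<pi>_def)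
      then show "\<bar>\<pi> * ((R - real (Suc k))^2 / R - 1)\<bar> \<le> \<pi> * (y^2 + 1)"
        unfolding grid_square y_def[symmetric] by (simp add: abs_mult \<pi>_def)
    qed (simp add: \<pi>_def)
    finally show ?thesis using True by (simp add: bd_def err_def \<pi>_def y_def grid_Suc algebra_simps min_def)
  next
    case False
    then have kn: "n \<le> k" by simp
    define \<pi> where "\<pi> = pmf p (Suc k)"
    have n0: "real n > 0" using R1 Rn by linarith
    have pk: "pmf p k = real n * \<pi> / R"
      using balance[of k] kn R1 by (simp add: \<pi>_def field_simps)
    let ?\<rho> = "\<lambda>\<theta>. (1 - \<theta>) * pmf p k + \<theta> * \<pi>"
    have s2: "(R - real n)^2 / R = s^2" using grid_square[of n] by (simp add: grid_def s_def)
    have "\<bar>J k + dl * ((R + real n) / 2 * ?\<rho> 1 * g (grid k + dl) - (R + real n) / 2 * ?\<rho> 0 * g (grid k))\<bar>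
        \<le> dl * (0 + \<bar>\<pi> * ((R - real n)^2 / R)\<bar> * dl * (1 / s) / 8)"
      unfolding J_def \<pi>_def[symmetric]
    proof (rule cell_error[where \<rho> = ?\<rho> and \<alpha> = "\<lambda>\<theta>. (R + real n) / 2" and \<beta> = "\<lambda>\<theta>. R - real n"
          and \<gamma> = "\<lambda>\<theta>. (R + real n) / 2 * (\<pi> - pmf p k)" and res = "\<lambda>_. 0", OF dl_pos g _ contH])
      fix \<theta> :: real
      show "((\<lambda>\<theta>. (R + real n) / 2 * ?\<rho> \<theta>) has_real_derivative (R + real n) / 2 * (\<pi> - pmf p k)) (at \<theta>)"
        by (rule DERIV_cmult) (auto intro!: derivative_eq_intros)
      show "(R - real n) * ?\<rho> \<theta> - (R + real n) / 2 * (\<pi> - pmf p k)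
         = 0 + \<pi> * ((R - real n)^2 / R) * (\<theta> - 1/2)"
        unfolding pk using R1 by (simp add: power2_eq_square field_simps)
      assume \<theta>: "0 \<le> \<theta>" "\<theta> \<le> 1"
      let ?z = "grid k + dl * \<theta>"
      show "H ?z = - dl * ((R + real n) / 2 * (dl * g' ?z) + (R - real n) * g ?z)"
        using var_coeff_tail_cell[OF kn \<theta>(1)] by (intro H_form)
      show "\<bar>0 * g ?z\<bar> \<le> 0" by simp
      show "\<bar>g' ?z\<bar> \<le> 1 / s" using var_coeff_tail_cell[OF kn \<theta>(1)] by (intro g'_tail)
    qed (auto intro!: continuous_intros)
    also have "\<dots> = dl^2 * (s * \<pi> / 8)"
      unfolding s2 using s_pos by (simp add: abs_mult \<pi>_def power2_eq_square)
    also have "\<dots> \<le> dl^2 * (s * \<pi>)" using s_pos by (intro mult_left_mono) (auto simp: \<pi>_def)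
    finally show ?thesis using kn by (simp add: bd_def err_def \<pi>_def grid_Suc algebra_simps min_absorb2)
  qed

  \<comment> \<open>\<open>c k\<close> and \<open>c' k\<close> are the right and left halves of the
    kernel around \<open>grid k\<close>; regrouping the cells by states leaves one unpaired left
    half at \<open>N\<close>.\<close>
  define c where "c = (\<lambda>k. integral {0..1} (\<lambda>\<theta>. (1 - \<theta>) * H (grid k + dl * \<theta>)))"
  define c' where "c' = (\<lambda>k. integral {0..1} (\<lambda>\<theta>. \<theta> * H (grid k - dl + dl * \<theta>)))"
  have cont: "continuous_on {0..1} (\<lambda>\<theta>. H (x + dl * \<theta>))" for x
    by (intro continuous_on_compose2[OF contH] continuous_intros) auto
  have J0: "J0 = pmf p 0 * c' 0" by (simp add: J0_def c'_def mult.assoc mult.left_commute[of _ "pmf p 0"])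
  have J: "J k = pmf p k * c k + pmf p (Suc k) * c' (Suc k)" for k
  proof -
    have "J k = integral {0..1} (\<lambda>\<theta>. pmf p k * ((1 - \<theta>) * H (grid k + dl * \<theta>))
        + pmf p (Suc k) * (\<theta> * H (grid (Suc k) - dl + dl * \<theta>)))"
      unfolding J_def grid_Suc by (simp add: algebra_simps)
    also have "\<dots> = pmf p k * c k + pmf p (Suc k) * c' (Suc k)"
      unfolding c_def c'_def
      by (subst integral_add)
         (auto intro!: integrable_continuous_interval continuous_intros cont)
    finally show ?thesis .
  qed

  have sum_J: "J0 + (\<Sum>k<N. J k) = (\<Sum>k<N. pmf p k * (c k + c' k)) + pmf p N * c' N" for N
    by (induction N) (auto simp: J0 J algebra_simps)
  have sum_err: "\<bar>J0 + (\<Sum>k<N. J k) + dl * bd N\<bar> \<le> dl^2 * (\<Sum>j\<le>N. err j)" for N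
  proof (induction N)
    case 0 then show ?case using cell0 by simp
  next
    case (Suc N)
    have "\<bar>J0 + (\<Sum>k<Suc N. J k) + dl * bd (Suc N)\<bar>
        \<le> \<bar>J0 + (\<Sum>k<N. J k) + dl * bd N\<bar> + \<bar>J N + dl * (bd (Suc N) - bd N)\<bar>"
      by (simp add: algebra_simps)
    then show ?case using Suc cell[of N] by (simp add: distrib_left)
  qed
  have err_bound: "(\<Sum>j\<le>N. err j) \<le> K * (36 * min 1 s) + 1" for N
  proof -
    have err0: "0 \<le> err j" for j using K0 s_pos by (simp add: err_def)
    have "(\<Sum>j\<le>N. err j) \<le> (\<Sum>j\<in>{..n} \<union> {Suc n..N}. err j)"
      by (intro sum_mono2) (auto simp: err0)
    also have "\<dots> = (\<Sum>j\<le>n. err j) + (\<Sum>j\<in>{Suc n..N}. err j)"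
      by (intro sum.union_disjoint) auto
    also have "(\<Sum>j\<le>n. err j) = K * (\<Sum>j\<le>n. pmf p j * (1 + \<bar>grid j\<bar>^3))"
      by (simp add: err_def sum_distrib_left)
    also have "\<dots> \<le> K * (36 * min 1 s)" using third_moment_left K0 by (intro mult_left_mono) auto
    also have "(\<Sum>j\<in>{Suc n..N}. err j) = s * measure_pmf.prob p {Suc n..N}"
      by (simp add: err_def sum_distrib_left measure_measure_pmf_finite)
    also have "\<dots> \<le> s * measure_pmf.prob p {n..}"
      using s_pos by (intro mult_left_mono measure_pmf.finite_measure_mono) auto
    also have "\<dots> \<le> 1" by (rule s_prob_ge_n)
    finally show ?thesis by simp
  qed

  have H_growth: "\<bar>H (grid k)\<bar> \<le> (\<bar>H 0\<bar> + R) + 1 * real k" for k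
  proof -
    have "\<bar>grid k\<bar> \<le> \<bar>real k - R\<bar> * 1"
      unfolding grid_def abs_mult using dl_pos dl_le_1 by (intro mult_left_mono) auto
    then show ?thesis using H_lip[of "grid k" 0] R1 by simp
  qed
  have smooth: "\<bar>c k + c' k - H (grid k)\<bar> \<le> 2 * dl^2" for k
    unfolding c_def c'_def by (rule triangle_smoothing_error[OF H H'_lip])
  have c'_growth: "\<bar>c' k\<bar> \<le> (\<bar>H 0\<bar> + R + 1) + 1 * real k" for k
  proof -
    have "\<bar>c' k\<bar> \<le> \<bar>H (grid k)\<bar> + 1"
      unfolding c'_def
    proof (rule has_integral_unit_bound[OF integrable_integral])
      show "(\<lambda>\<theta>. \<theta> * H (grid k - dl + dl * \<theta>)) integrable_on {0..1}"
        by (intro integrable_continuous_interval continuous_intros cont)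
      fix \<theta> :: real assume \<theta>: "0 \<le> \<theta>" "\<theta> \<le> 1"
      have "\<bar>- dl + dl * \<theta>\<bar> = dl * (1 - \<theta>)" using \<theta> dl_pos
        by (simp add: abs_if algebra_simps mult_left_le)
      also have "\<dots> \<le> 1" using \<theta> dl_pos dl_le_1 by (intro mult_le_one) auto
      finally have "\<bar>H (grid k - dl + dl * \<theta>)\<bar> \<le> \<bar>H (grid k)\<bar> + 1"
        using H_lip[of "grid k - dl + dl * \<theta>" "grid k"] by linarith
      then have "\<theta> * \<bar>H (grid k - dl + dl * \<theta>)\<bar> \<le> 1 * (\<bar>H (grid k)\<bar> + 1)"
        using \<theta> by (intro mult_mono) auto
      then show "\<bar>\<theta> * H (grid k - dl + dl * \<theta>)\<bar> \<le> \<bar>H (grid k)\<bar> + 1"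
        using \<theta> by (simp add: abs_mult)
    qed
    then show ?thesis using H_growth[of k] by simp
  qed
  have g_growth: "\<bar>(R + real (min k n)) / 2 * g (grid k)\<bar> \<le> (R + real n) * K + (R + real n) / s * real k" for k
  proof -
    have g_le: "\<bar>g (grid k)\<bar> \<le> K + 1 / s * real k"
    proof (cases "k \<le> n")
      case True
      then have "grid k \<le> s" unfolding grid_def s_def using dl_pos by (intro mult_right_mono) auto
      then show ?thesis using gK s_pos by (simp add: add_increasing2)
    next
      case False
      then have sk: "s \<le> grid k" unfolding grid_def s_def using dl_pos by (intro mult_right_mono) auto
      have "\<bar>g (grid k) - g s\<bar> \<le> 1 / s * grid k - 1 / s * s"
        by (rule increment_bound[OF sk g, where V = "\<lambda>x. 1 / s * x" and F = "\<lambda>_. 1 / s"])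
          (use s_pos in \<open>auto intro!: derivative_eq_intros g'_tail\<close>)
      moreover have "1 / s * grid k \<le> 1 / s * real k"
      proof (intro mult_left_mono)
        have "grid k \<le> (real k - R) * 1"
          unfolding grid_def using dl_le_1 False Rn by (intro mult_left_mono) auto
        then show "grid k \<le> real k" using R1 by simp
      qed (use s_pos in auto)
      ultimately show ?thesis using gK[of s] s_pos by (simp add: abs_if split: if_splits)
    qed
    have "\<bar>(R + real (min k n)) / 2 * g (grid k)\<bar> \<le> (R + real n) * (K + 1 / s * real k)"
      unfolding abs_mult using g_le R1 by (intro mult_mono) auto
    then show ?thesis by (simp add: algebra_simps)
  qed
  \<comment> \<open>The unpaired half and the last boundary term grow at most linearly in
    \<open>N\<close>, so the finite first moment makes them vanish.\<close>
  have "(\<lambda>N. \<bar>pmf p N * c' N\<bar> + dl * \<bar>pmf p N * ((R + real (min N n)) / 2 * g (grid N))\<bar>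
      + (K * (36 * min 1 s) + 3) * dl^2) \<longlonglongrightarrow> \<bar>0\<bar> + dl * \<bar>0\<bar> + (K * (36 * min 1 s) + 3) * dl^2"
    by (intro tendsto_intros linear_growth_vanishes[OF c'_growth] linear_growth_vanishes[OF g_growth])
  moreover have "(\<lambda>N. \<bar>\<Sum>k<N. pmf p k * H (grid k)\<bar>) \<longlonglongrightarrow> \<bar>E (\<lambda>k. H (grid k))\<bar>"
    using nat_pmf_expectation_sums[OF integrable_affine_bounded[OF H_growth]]
    by (intro tendsto_rabs) (simp add: sums_def)
  moreover have "\<bar>\<Sum>k<N. pmf p k * H (grid k)\<bar> \<le>
      \<bar>pmf p N * c' N\<bar> + dl * \<bar>pmf p N * ((R + real (min N n)) / 2 * g (grid N))\<bar>
      + (K * (36 * min 1 s) + 3) * dl^2" for N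
  proof -
    have "\<bar>(\<Sum>k<N. pmf p k * (c k + c' k)) - (\<Sum>k<N. pmf p k * H (grid k))\<bar>
        = \<bar>\<Sum>k<N. pmf p k * (c k + c' k - H (grid k))\<bar>"
      by (simp add: right_diff_distrib sum_subtractf)
    also have "\<dots> \<le> (\<Sum>k<N. pmf p k * (2 * dl^2))"
      by (rule order_trans[OF sum_abs], rule sum_mono)
         (auto simp: abs_mult intro!: mult_left_mono smooth)
    also have "\<dots> = measure_pmf.prob p {..<N} * (2 * dl^2)"
      by (simp add: sum_distrib_right measure_measure_pmf_finite)
    also have "\<dots> \<le> 1 * (2 * dl^2)" by (intro mult_right_mono) auto
    finally have 1: "\<bar>(\<Sum>k<N. pmf p k * (c k + c' k)) - (\<Sum>k<N. pmf p k * H (grid k))\<bar> \<le> 2 * dl^2" by simp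
    have "dl^2 * (\<Sum>j\<le>N. err j) \<le> dl^2 * (K * (36 * min 1 s) + 1)"
      by (intro mult_left_mono err_bound) auto
    then have "\<bar>J0 + (\<Sum>k<N. J k) + dl * bd N\<bar> \<le> dl^2 * (K * (36 * min 1 s) + 1)"
      using sum_err[of N] by linarith
    moreover have "\<bar>dl * bd N\<bar> = dl * \<bar>pmf p N * ((R + real (min N n)) / 2 * g (grid N))\<bar>"
      using dl_pos by (simp add: bd_def abs_mult mult_ac)
    moreover have "(K * (36 * min 1 s) + 3) * dl^2 = dl^2 * (K * (36 * min 1 s) + 1) + 2 * dl^2"
      by (simp add: algebra_simps)
    ultimately show ?thesis using 1 sum_J[of N] by linarith
  qed
  ultimately show ?thesis by (intro LIMSEQ_le[of _ "\<bar>E (\<lambda>k. H (grid k))\<bar>"]) auto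
qed

end

section \<open>Conclusion\<close>

lemma W2_iff:
  "h \<in> W2 \<longleftrightarrow> (\<forall>x. h differentiable at x) \<and> (\<forall>x y. \<bar>h x - h y\<bar> \<le> \<bar>x - y\<bar>)
     \<and> (\<forall>x y. \<bar>deriv h x - deriv h y\<bar> \<le> \<bar>x - y\<bar>)"
  by (auto simp: W2_def Lip1_def lipschitz_on_def dist_real_def)

context erlangC_law
begin

section \<open>Identification of the coefficients and of the limiting density\<close>

lemma zeta_eq: "zeta R n = - s"
  by (simp add: zeta_def s_def dl_def diff_divide_distrib)

lemma drift_eq: "drift R mu n x = mu * (- min x s)"
  unfolding drift_def neg_part_def zeta_eq by (auto simp: min_def max_def)

lemma diffusion_eq: "diffusion R mu n x = mu * var_coeff s dl x"
proof -
  have "neg_part (x + zeta R n) + zeta R n = - min x s"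
    unfolding neg_part_def zeta_eq by (auto simp: min_def max_def)
  then have "diffusion R mu n x = mu * (1 + indicator {- sqrt R<..} x * (1 + dl * min x s))"
    by (simp add: diffusion_def dl_def)
  moreover have "indicator {- sqrt R<..} x * (1 + dl * min x s) = max 0 (1 + dl * min x s)"
  proof (cases "- sqrt R < x")
    case True
    have "dl * (- sqrt R) \<le> dl * min x s"
      using True s_pos dl_pos R1 by (intro mult_left_mono) (auto intro: order_trans[of _ 0])
    then have "0 \<le> 1 + dl * min x s" using dl_sqrt by (simp add: mult.commute)
    then show ?thesis using True by simp
  next
    case False
    then have "dl * min x s \<le> dl * (- sqrt R)"
      using dl_pos by (intro mult_left_mono) auto
    then have "1 + dl * min x s \<le> 0" using dl_sqrt by (simp add: mult.commute)
    then show ?thesis using False by simp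
  qed
  ultimately show ?thesis by (simp add: var_coeff_def)
qed

text \<open>The factor 1/2 makes \<open>2 * m / A\<close> the unnormalized density for
  \<open>mu = 1\<close>; in the exponent \<open>mu\<close> cancels.\<close>

definition m :: "real \<Rightarrow> real" where
  "m x = exp (LBINT y=ereal 0..ereal x. 2 * (- min y s) / var_coeff s dl y) / 2"

lemma m_deriv: "(m has_real_derivative - min x s * (2 * m x / var_coeff s dl x)) (at x)"
proof -
  let ?q = "\<lambda>y. 2 * (- min y s) / var_coeff s dl y"
  have "var_coeff s dl y \<noteq> 0" for y by (simp add: var_coeff_def add_pos_nonneg less_imp_neq[symmetric])
  moreover have "continuous_on UNIV (var_coeff s dl)" unfolding var_coeff_def by (intro continuous_intros)
  ultimately have cont: "continuous_on UNIV ?q" by (intro continuous_intros) auto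
  obtain F where F: "\<And>x. (F has_real_derivative ?q x) (at x)"
    using continuous_antiderivative[OF cont] by blast
  have "(LBINT y=ereal 0..ereal x. ?q y) = F x - F 0" for x
  proof (rule interval_integral_FTC_finite)
    show "continuous_on {min 0 x..max 0 x} ?q" using cont by (rule continuous_on_subset) auto
    show "(F has_vector_derivative ?q y) (at y within {min 0 x..max 0 x})" for y
      using F by (auto simp: has_real_derivative_iff_has_vector_derivative[symmetric]
        intro: has_field_derivative_at_within)
  qed
  then have m_eq: "m = (\<lambda>x. exp (F x - F 0) / 2)" by (simp add: m_def fun_eq_iff)
  show ?thesis
    unfolding m_eq by (rule derivative_eq_intros F refl | simp)+
qed

sublocale stein_diffusion s dl m
  by unfold_locales (use s_pos dl_pos dl_le_1 m_deriv in \<open>auto simp: m_def\<close>)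

lemma unnormalized_density_eq:
  assumes "mu > 0"
  shows "unnormalized_density R mu n x = u x / mu"
proof -
  have "2 * drift R mu n y / diffusion R mu n y = 2 * (- min y s) / var_coeff s dl y" for y
    using assms by (simp add: drift_eq diffusion_eq)
  then show ?thesis
    using assms by (simp add: unnormalized_density_def diffusion_eq u_def m_def field_simps)
qed

lemma diffusion_density_eq:
  assumes "mu > 0"
  shows "diffusion_density R mu n x = u x / Z"
  using assms Z_pos by (simp add: diffusion_density_def kappa_def unnormalized_density_eq flip: Z_def)

lemma integral_diffusion_law:
  assumes "mu > 0" and [measurable]: "h \<in> borel_measurable borel"
  shows "(\<integral>x. h x \<partial>diffusion_law R mu n) = (\<integral>x. h x * u x \<partial>lborel) / Z"
proof -
  have "(\<integral>x. h x \<partial>diffusion_law R mu n) = (\<integral>x. (u x / Z) *\<^sub>R h x \<partial>lborel)"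
    unfolding diffusion_law_def diffusion_density_eq[OF assms(1)]
    using u_pos Z_pos by (intro integral_density) (auto simp: less_imp_le)
  also have "\<dots> = (\<integral>x. h x * u x / Z \<partial>lborel)" by (simp add: mult.commute)
  finally show ?thesis by simp
qed

lemma integral_scaled_law:
  fixes h :: "real \<Rightarrow> real"
  shows "(\<integral>x. h x \<partial>scaled_law R p) = E (\<lambda>k. h (grid k))"
  by (simp add: scaled_law_def grid_def dl_def)

lemma W2_error:
  assumes mu: "mu > 0" and h: "h \<in> W2"
  shows "\<bar>(\<integral>x. h x \<partial>scaled_law R p) - (\<integral>x. h x \<partial>diffusion_law R mu n)\<bar> \<le> 30000 / R"
proof -
  have lip: "\<And>x y. \<bar>h x - h y\<bar> \<le> \<bar>x - y\<bar>" and lip': "\<And>x y. \<bar>deriv h x - deriv h y\<bar> \<le> \<bar>x - y\<bar>"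
    and diff: "\<And>x. (h has_real_derivative deriv h x) (at x)"
    using h by (auto simp: W2_iff DERIV_deriv_iff_real_differentiable)
  define hbar where "hbar = (\<integral>x. h x * u x \<partial>lborel) / Z"
  define K where "K = 400 * (1 + 1 / s)"
  have "continuous_on UNIV h" using diff by (meson DERIV_isCont continuous_at_imp_continuous_on)
  then have meas: "h \<in> borel_measurable borel" by (rule borel_measurable_continuous_onI)
  obtain g g' where g: "\<And>x. (g has_real_derivative g' x) (at x)"
    "\<And>x. A x / 2 * g' x - min x s * g x = hbar - h x"
    "\<And>x. x \<le> s \<Longrightarrow> \<bar>g x\<bar> \<le> K"
    "\<And>x. x \<le> s \<Longrightarrow> \<bar>g' x\<bar> \<le> K * (1 + \<bar>x\<bar>)"
    "\<And>x. s \<le> x \<Longrightarrow> \<bar>g' x\<bar> \<le> 1 / s"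
    unfolding hbar_def K_def using stein_equation_solution[OF lip] by blast
  have ode: "A x / 2 * g' x - min x s * g x = - (h x - hbar)" for x using g(2)[of x] by simp
  have "\<bar>E (\<lambda>k. h (grid k) - hbar)\<bar> \<le> (K * (36 * min 1 s) + 3) * dl^2"
    by (rule stein_error[where H = "\<lambda>x. h x - hbar" and H' = "deriv h", OF g(1) ode g(3-5)])
       (auto intro!: derivative_eq_intros diff lip lip')
  also have "\<dots> \<le> 30000 * dl^2"
  proof (intro mult_right_mono)
    have "(1 + 1 / s) * min 1 s \<le> 2" using s_pos by (auto simp: min_def field_simps)
    moreover have "K * (36 * min 1 s) = 14400 * ((1 + 1 / s) * min 1 s)" by (simp add: K_def)
    ultimately show "K * (36 * min 1 s) + 3 \<le> 30000" by linarith
  qed simp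
  also have "dl^2 = 1 / R" using R1 by (simp add: dl_def power_divide)
  finally have "\<bar>E (\<lambda>k. h (grid k) - hbar)\<bar> \<le> 30000 / R" by simp
  moreover have "integrable (measure_pmf p) (\<lambda>k. h (grid k))"
  proof (rule integrable_affine_bounded)
    fix k
    have "\<bar>grid k\<bar> \<le> \<bar>real k - R\<bar> * 1"
      unfolding grid_def abs_mult using dl_pos dl_le_1 by (intro mult_left_mono) auto
    then show "\<bar>h (grid k)\<bar> \<le> (\<bar>h 0\<bar> + R) + 1 * real k" using lip[of "grid k" 0] R1 by simp
  qed
  then have "E (\<lambda>k. h (grid k) - hbar) = E (\<lambda>k. h (grid k)) - hbar" by simp
  ultimately show ?thesis
    by (simp add: integral_scaled_law integral_diffusion_law[OF mu meas] hbar_def)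
qed

end

theorem theorem1p1:
  "\<exists>C::real. C > 0 \<and>
     (\<forall>(n::nat) (lam::real) (mu::real) (R::real).
        n \<ge> 1 \<and> lam > 0 \<and> mu > 0 \<and> R = lam / mu \<and> 1 \<le> R \<and> R < real n \<longrightarrow>
        (\<forall>P p. ctmc_with_rates (erlangC_rate lam mu n) P \<and> stationary_distribution P p \<longrightarrow>
           d_W2 (scaled_law R p) (diffusion_law R mu n) \<le> ereal (C / R)))"
proof (intro exI[of _ 30000] conjI allI impI)
  fix n :: nat and lam mu R :: real and P p
  assume par: "n \<ge> 1 \<and> lam > 0 \<and> mu > 0 \<and> R = lam / mu \<and> 1 \<le> R \<and> R < real n"
    and P: "ctmc_with_rates (erlangC_rate lam mu n) P \<and> stationary_distribution P p"
  interpret erlangC_law n R p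
  proof
    show "1 \<le> R" "R < real n" using par by auto
    show "R * pmf p k = real (min (Suc k) n) * pmf p (Suc k)" for k
      using erlangC_detailed_balance[of lam mu n P p k] P par by (simp add: field_simps)
  qed
  show "d_W2 (scaled_law R p) (diffusion_law R mu n) \<le> ereal (30000 / R)"
    unfolding d_W2_def using W2_error par by (intro SUP_least) simp
qed simp

end
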